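(* Let $G$ be a finite group, $H$ a subgroup, and $S=\{s_1,\ldots,s_k\}\subseteq G\setminus H$ a set of representatives of pairwise distinct double cosets $HsH$ with $\langle H,S\rangle=G$, and suppose $\mathcal{G}=\mathcal{G}(G,H,S)$ is not complete. Suppose $\mathcal{G}$ is hierarchical with respect to this ordering, i.e. the subgroups $G_i=\langle H,s_1,\ldots,s_i\rangle$ ($1\le i\le k$) are distinct. Let $d_i=d_{s_1}+\cdots+d_{s_i}$. Suppose that $d_{s_{i+1}}\leq d_i$ for each $i$ and that $|G_1/H|\geq d_2$. Then $\kappa(\mathcal{G})=d(\mathcal{G})$.
   Context: The Cayley coset digraph $\mathcal{G}(G,H,S)$ has vertex set $G/H$ of left cosets of $H$, and $(gH,g'H)$ is an edge iff $gHs\cap g'H\neq\emptyset$ for some $s\in S$. For $s\in S$, $d_s=|HsH/H|$ is the number of left cosets of $H$ contained in $HsH$; the degree of $\mathcal{G}$ is $d(\mathcal{G})=\sum_{s\in S}d_s$. $|G_1/H|$ is the index of $H$ in $G_1$. $\kappa$ denotes the vertex connectivity: the smallest number of vertices whose removal leaves a digraph that is not strongly connected (for a complete digraph on $m$ vertices it is $m-1$). *)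

theory Defs
  imports "HOL-Algebra.Left_Coset" "HOL-Algebra.Generated_Groups" "Graph_Theory.Kuratowski"
begin

definition double_coset :: "('a, 'b) monoid_scheme \<Rightarrow> 'a set \<Rightarrow> 'a \<Rightarrow> 'a set" where
  "double_coset G H s = (H #>\<^bsub>G\<^esub> s) <#>\<^bsub>G\<^esub> H"

definition cayley_coset_digraph ::
    "('a, 'b) monoid_scheme \<Rightarrow> 'a set \<Rightarrow> 'a set \<Rightarrow> ('a set, 'a set \<times> 'a set) pre_digraph" where
  "cayley_coset_digraph G H S =
     \<lparr> verts = lcosets\<^bsub>G\<^esub> H,
       arcs = {(A, B). A \<in> lcosets\<^bsub>G\<^esub> H \<and> B \<in> lcosets\<^bsub>G\<^esub> H \<and>
                       (\<exists>s\<in>S. (A #>\<^bsub>G\<^esub> s) \<inter> B \<noteq> {})},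
       tail = fst, head = snd \<rparr>"

definition coset_degree :: "('a, 'b) monoid_scheme \<Rightarrow> 'a set \<Rightarrow> 'a \<Rightarrow> nat" where
  "coset_degree G H s = card {C \<in> lcosets\<^bsub>G\<^esub> H. C \<subseteq> double_coset G H s}"

definition cayley_coset_degree :: "('a, 'b) monoid_scheme \<Rightarrow> 'a set \<Rightarrow> 'a set \<Rightarrow> nat" where
  "cayley_coset_degree G H S = (\<Sum>s\<in>S. coset_degree G H s)"

definition lcoset_index :: "('a, 'b) monoid_scheme \<Rightarrow> 'a set \<Rightarrow> 'a set \<Rightarrow> nat" where
  "lcoset_index G K H = card (lcosets\<^bsub>G\<lparr>carrier := K\<rparr>\<^esub> H)"

definition gen_chain :: "('a, 'b) monoid_scheme \<Rightarrow> 'a set \<Rightarrow> (nat \<Rightarrow> 'a) \<Rightarrow> nat \<Rightarrow> 'a set" where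
  "gen_chain G H s i = generate G (H \<union> s ` {1..i})"

definition hierarchical :: "('a, 'b) monoid_scheme \<Rightarrow> 'a set \<Rightarrow> (nat \<Rightarrow> 'a) \<Rightarrow> nat \<Rightarrow> bool" where
  "hierarchical G H s k \<longleftrightarrow> inj_on (gen_chain G H s) {1..k}"

abbreviation is_complete :: "('a, 'b) pre_digraph \<Rightarrow> bool" where
  "is_complete D \<equiv> complete_digraph (card (verts D)) D"

text \<open>
  For finite loop-free digraphs. The empty digraph is not \<^const>\<open>strongly_connected\<close>, so deleting
  all vertices is admitted below; this does not affect the minimum, since a non-complete digraph
  can be disconnected by deleting all vertices except two suitable ones.
\<close>
definition vertex_connectivity :: "('a, 'b) pre_digraph \<Rightarrow> nat" where
  "vertex_connectivity D =
     (if is_complete D then card (verts D) - 1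
      else (LEAST n. \<exists>X \<subseteq> verts D. card X = n \<and> \<not> strongly_connected (D \<restriction> (verts D - X))))"

end

theory Submission
  imports Defs
begin

text \<open>
  A smallest fragment \<open>A\<close> (atom) of the coset digraph or of its reversal is a block of the left
  translation action (Mader, Watkins, Hamidoune), so a translate of it is \<open>K/H\<close> for a proper
  subgroup \<open>K\<close> of \<open>G\<close> containing \<open>H\<close>. Hence the connectivity is at least the minimum of
  \<open>|KS'H \ K| / |H|\<close>, where \<open>S'\<close> is \<open>S\<close> or the set of inverses of \<open>S\<close>. All hypotheses are
  invariant under inverting the generators, so only \<open>S\<close> has to be considered.

  For every subgroup \<open>H \<le> K < G\<^sub>n\<close>, the union \<open>W\<close> of the sets \<open>K s\<^sub>j H\<close> with \<open>j \<le> n\<close> and \<open>s\<^sub>j \<notin> K\<close> has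
  at least \<open>|H| d\<^sub>n\<close> elements, by induction on \<open>n\<close>: given \<open>K < G\<^bsub>n+1\<^esub>\<close>, put \<open>L = K \<inter> G\<^sub>n\<close>. If \<open>L = G\<^sub>n\<close>, then
  \<open>W\<close> contains a right coset of \<open>K\<close>, and \<open>|G\<^sub>n/H| \<ge> d\<^bsub>n+1\<^esub>\<close> because the indices at least double
  along the chain. Otherwise \<open>W\<close> contains the union \<open>W' \<subseteq> G\<^sub>n\<close> belonging to \<open>L\<close>; if moreover
  \<open>s\<^bsub>n+1\<^esub> \<in> K\<close> it also contains the disjoint translate \<open>s\<^bsub>n+1\<^esub> W'\<close>, and if not, the disjoint double
  coset of \<open>s\<^bsub>n+1\<^esub>\<close>.
\<close>

section \<open>Fragments and atoms\<close>

text \<open>Deleting these vertices cuts every edge that leaves \<open>F\<close>, so boundaries play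
  the role of separators.\<close>

definition boundary :: "'v rel \<Rightarrow> 'v set \<Rightarrow> 'v set" where
  "boundary E F = E `` F - F"

text \<open>A vertex in either boundary on the left lies in one of the boundaries on the right, and
  a vertex in both on the left lies in both on the right; inclusion-exclusion then compares the
  sums.\<close>

lemma boundary_submodular:
  assumes "finite (boundary E X)" "finite (boundary E Y)"
  shows "card (boundary E (X \<inter> Y)) + card (boundary E (X \<union> Y))
           \<le> card (boundary E X) + card (boundary E Y)"
proof -
  let ?I = "boundary E (X \<inter> Y)" and ?U = "boundary E (X \<union> Y)"
  have sub: "?I \<union> ?U \<subseteq> boundary E X \<union> boundary E Y" "?I \<inter> ?U \<subseteq> boundary E X \<inter> boundary E Y"
    unfolding boundary_def by auto
  have "finite (?I \<union> ?U)"
    using finite_subset[OF sub(1)] assms by blast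
  then have "card ?I + card ?U = card (?I \<union> ?U) + card (?I \<inter> ?U)"
    by (intro card_Un_Int) auto
  also have "\<dots> \<le> card (boundary E X \<union> boundary E Y) + card (boundary E X \<inter> boundary E Y)"
    by (intro add_mono card_mono sub) (use assms in auto)
  also have "\<dots> = card (boundary E X) + card (boundary E Y)"
    using card_Un_Int[OF assms] by simp
  finally show ?thesis .
qed

text \<open>In the application \<open>V\<close> is the group and \<open>L\<close> consists of the unions of left cosets of \<open>H\<close>, so
  that vertex sets of the coset digraph are handled as sets of group elements.\<close>

locale vertex_lattice =
  fixes V :: "'v set" and L :: "'v set set" and E :: "'v rel"
  assumes finite_V: "finite V"
    and L_subset: "F \<in> L \<Longrightarrow> F \<subseteq> V"
    and E_subset: "E \<subseteq> V \<times> V"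
    and Int_closed: "X \<in> L \<Longrightarrow> Y \<in> L \<Longrightarrow> X \<inter> Y \<in> L"
    and compl_closed: "X \<in> L \<Longrightarrow> V - X \<in> L"
    and image_closed: "X \<in> L \<Longrightarrow> E `` X \<in> L"
    and preimage_closed: "X \<in> L \<Longrightarrow> E\<inverse> `` X \<in> L"
begin

lemma vertex_lattice_converse: "vertex_lattice V L (E\<inverse>)"
  using finite_V L_subset E_subset Int_closed compl_closed image_closed preimage_closed
  by unfold_locales auto

lemma Un_closed: "X \<in> L \<Longrightarrow> Y \<in> L \<Longrightarrow> X \<union> Y \<in> L"
proof -
  assume XY: "X \<in> L" "Y \<in> L"
  then have "V - ((V - X) \<inter> (V - Y)) \<in> L"
    by (intro compl_closed Int_closed)
  moreover have "V - ((V - X) \<inter> (V - Y)) = X \<union> Y"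
    using XY L_subset by blast
  ultimately show ?thesis by simp
qed

text \<open>The last condition leaves some vertex outside \<open>F\<close> and its boundary, so that
  the boundary really separates something.\<close>

definition fragment :: "'v set \<Rightarrow> bool" where
  "fragment F \<longleftrightarrow> F \<in> L \<and> F \<noteq> {} \<and> F \<union> E `` F \<noteq> V"

lemma finite_boundary: "finite (boundary E F)"
  by (rule finite_subset[OF _ finite_V]) (use E_subset in \<open>auto simp: boundary_def\<close>)

lemma fragment_subset: "fragment F \<Longrightarrow> F \<subseteq> V"
  using L_subset fragment_def by auto

lemma fragment_finite: "fragment F \<Longrightarrow> finite F"
  using finite_V fragment_subset finite_subset by blast

lemma card_fragment_partition:
  assumes "F \<subseteq> V"
  shows "card F + card (boundary E F) + card (V - (F \<union> E `` F)) = card V"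
proof -
  have V: "V = (F \<union> boundary E F) \<union> (V - (F \<union> E `` F))"
    using assms E_subset unfolding boundary_def by blast
  have fin: "finite F" "finite (boundary E F)"
    using assms finite_V finite_subset finite_boundary by blast+
  have "card ((F \<union> boundary E F) \<union> (V - (F \<union> E `` F)))
      = card (F \<union> boundary E F) + card (V - (F \<union> E `` F))"
    by (rule card_Un_disjoint) (use fin finite_V in \<open>auto simp: boundary_def\<close>)
  also have "card (F \<union> boundary E F) = card F + card (boundary E F)"
    by (rule card_Un_disjoint) (use fin in \<open>auto simp: boundary_def\<close>)
  finally show ?thesis
    using V by simp
qed

lemma dual_fragment:
  assumes "fragment F"
  shows "vertex_lattice.fragment V L (E\<inverse>) (V - (F \<union> E `` F))"
    and "card (boundary (E\<inverse>) (V - (F \<union> E `` F))) \<le> card (boundary E F)"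
proof -
  interpret conv: vertex_lattice V L "E\<inverse>" by (rule vertex_lattice_converse)
  have F: "F \<in> L" "F \<noteq> {}" "F \<union> E `` F \<noteq> V" "F \<subseteq> V"
    using assms fragment_def L_subset by auto
  have "V - (F \<union> E `` F) \<in> L"
    using F Un_closed image_closed compl_closed by simp
  moreover have "V - (F \<union> E `` F) \<noteq> {}"
    using F E_subset by blast
  moreover have "(V - (F \<union> E `` F) \<union> E\<inverse> `` (V - (F \<union> E `` F))) \<inter> F = {}"
    by blast
  ultimately show "conv.fragment (V - (F \<union> E `` F))"
    unfolding conv.fragment_def using F by blast
  have "boundary (E\<inverse>) (V - (F \<union> E `` F)) \<subseteq> boundary E F"
    using E_subset unfolding boundary_def by blast
  then show "card (boundary (E\<inverse>) (V - (F \<union> E `` F))) \<le> card (boundary E F)"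
    by (rule card_mono[OF finite_boundary])
qed

section \<open>Fragments with smallest boundary, their duals, and atoms\<close>

definition min_fragment :: "'v set \<Rightarrow> bool" where
  "min_fragment F \<longleftrightarrow> fragment F \<and>
     (\<forall>F'. fragment F' \<longrightarrow> card (boundary E F) \<le> card (boundary E F'))"

text \<open>Passing to the dual never enlarges the boundary, in either direction, so the minimum
  boundary sizes of \<open>E\<close> and of its reversal agree and duals attain them.\<close>

lemma dual_min_fragment:
  assumes "min_fragment F"
  shows "vertex_lattice.min_fragment V L (E\<inverse>) (V - (F \<union> E `` F))"
proof -
  interpret conv: vertex_lattice V L "E\<inverse>" by (rule vertex_lattice_converse)
  have F: "fragment F"
    using assms min_fragment_def by blast
  have "card (boundary (E\<inverse>) (V - (F \<union> E `` F))) \<le> card (boundary (E\<inverse>) F')"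
    if "conv.fragment F'" for F'
  proof -
    have "fragment (V - (F' \<union> E\<inverse> `` F'))"
      and le: "card (boundary E (V - (F' \<union> E\<inverse> `` F'))) \<le> card (boundary (E\<inverse>) F')"
      using conv.dual_fragment[OF that] by simp_all
    then have "card (boundary E F) \<le> card (boundary E (V - (F' \<union> E\<inverse> `` F')))"
      using assms min_fragment_def by blast
    with dual_fragment(2)[OF F] le show ?thesis by linarith
  qed
  then show ?thesis
    unfolding conv.min_fragment_def using dual_fragment(1)[OF F] by blast
qed

text \<open>The last conjunct takes the fragments of the reversed relation into account; without it,
  atoms may overlap properly.\<close>

definition atom :: "'v set \<Rightarrow> bool" where
  "atom A \<longleftrightarrow> min_fragment A \<and>
     (\<forall>F. min_fragment F \<longrightarrow> card A \<le> card F \<and> card A \<le> card (V - (F \<union> E `` F)))"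

text \<open>By submodularity, once \<open>A \<union> Y\<close> has a boundary of at least the
  minimum size, \<open>A \<inter> Y\<close> has a boundary of exactly that size. It is then a
  minimum fragment inside \<open>A\<close>, and the minimality of \<open>A\<close> leaves only
  \<open>A \<inter> Y = A\<close>.\<close>

lemma atom_subset_min_fragment:
  assumes A: "atom A" and Y: "min_fragment Y" and meet: "A \<inter> Y \<noteq> {}"
  shows "A \<subseteq> Y"
proof -
  have mA: "min_fragment A" and fA: "fragment A" and fY: "fragment Y"
    using A Y atom_def min_fragment_def by auto
  then have eq: "card (boundary E A) = card (boundary E Y)"
    using Y min_fragment_def by (meson le_antisym)
  have sub: "A \<subseteq> V" "Y \<subseteq> V" and fin: "finite A" "finite Y"
    using fA fY fragment_subset fragment_finite by auto
  have AL: "A \<in> L" "Y \<in> L"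
    using fA fY fragment_def by auto
  have "A \<inter> Y \<union> E `` (A \<inter> Y) \<subseteq> A \<union> E `` A" "A \<union> E `` A \<subset> V"
    using fA fragment_def sub E_subset by blast+
  then have fI: "fragment (A \<inter> Y)"
    unfolding fragment_def using meet AL Int_closed by blast
  then have I_ge: "card (boundary E A) \<le> card (boundary E (A \<inter> Y))"
    using mA min_fragment_def by blast
  have submod: "card (boundary E (A \<inter> Y)) + card (boundary E (A \<union> Y)) \<le> 2 * card (boundary E A)"
    using boundary_submodular[OF finite_boundary finite_boundary, of A Y] eq by simp
  have U_ge: "card (boundary E A) \<le> card (boundary E (A \<union> Y))"
  proof (cases "(A \<union> Y) \<union> E `` (A \<union> Y) = V")
    case True
    \<comment> \<open>Here \<open>A \<union> Y\<close> is not a fragment, and its boundary is all of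
      its complement. The comparison of \<open>A\<close> with the dual of \<open>Y\<close> shows
      that this complement is large enough.\<close>
    have "card A \<le> card (V - (Y \<union> E `` Y))"
      using A Y atom_def by blast
    then have "card Y + card (boundary E A) + card A \<le> card V"
      using card_fragment_partition[OF sub(2)] eq by linarith
    moreover have "card (A \<union> Y) + card (boundary E (A \<union> Y)) = card V"
      using card_fragment_partition[of "A \<union> Y"] True sub by simp
    moreover have "card (A \<union> Y) \<le> card A + card Y"
      by (rule card_Un_le)
    ultimately show ?thesis by linarith
  next
    case False
    then have "fragment (A \<union> Y)"
      unfolding fragment_def using meet AL Un_closed by blast
    then show ?thesis
      using mA min_fragment_def by blast
  qed
  have "card (boundary E (A \<inter> Y)) = card (boundary E A)"
    using I_ge U_ge submod by linarith
  then have "min_fragment (A \<inter> Y)"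
    using fI mA unfolding min_fragment_def by simp
  then have "card A \<le> card (A \<inter> Y)"
    using A atom_def by blast
  then have "A \<inter> Y = A"
    by (intro card_seteq) (use fin in auto)
  then show ?thesis by blast
qed

lemma atom_exists:
  assumes "fragment F"
  obtains A where "atom A" "card (boundary E A) \<le> card (boundary E F)"
  | A where "vertex_lattice.atom V L (E\<inverse>) A"
      "card (boundary (E\<inverse>) A) \<le> card (boundary E F)"
proof -
  interpret conv: vertex_lattice V L "E\<inverse>" by (rule vertex_lattice_converse)
  obtain F0 where F0: "min_fragment F0"
    using arg_min_nat_lemma[of fragment F "\<lambda>X. card (boundary E X)"] assms
    unfolding min_fragment_def by blast
  \<comment> \<open>Minimum fragments of both directions compete for the smallest cardinality,
    because the definition of an atom compares it with duals as well. The winner is an atom for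
    whichever direction it belongs to.\<close>
  define M where "M X \<longleftrightarrow> min_fragment X \<or> conv.min_fragment X" for X
  obtain A where MA: "M A" and least: "\<And>X. M X \<Longrightarrow> card A \<le> card X"
    using arg_min_nat_lemma[of M F0 card] F0 M_def by blast
  have dual: "conv.min_fragment (V - (X \<union> E `` X))" if "min_fragment X" for X
    using dual_min_fragment[OF that] .
  have dual': "min_fragment (V - (X \<union> E\<inverse> `` X))" if "conv.min_fragment X" for X
    using conv.dual_min_fragment[OF that] by simp
  show thesis
  proof (cases "min_fragment A")
    case True
    then have "atom A"
      unfolding atom_def using least dual M_def by blast
    moreover have "card (boundary E A) \<le> card (boundary E F)"
      using True assms min_fragment_def by blast
    ultimately show thesis using that(1) by blast
  next
    case False
    then have cA: "conv.min_fragment A"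
      using MA M_def by blast
    then have "conv.atom A"
      unfolding conv.atom_def using least dual' M_def by blast
    moreover have "card (boundary (E\<inverse>) A) \<le> card (boundary E F)"
      using cA dual_fragment[OF assms] unfolding conv.min_fragment_def by (meson le_trans)
    ultimately show thesis using that(2) by blast
  qed
qed

text \<open>Under an automorphism the image of an atom is again a minimum fragment; if it meets the
  atom, it contains it, and both have the same size. Atoms are thus blocks for any group of
  automorphisms.\<close>

lemma atom_image_eq:
  assumes A: "atom A" and f: "bij_betw f V V"
    and f_L: "\<And>X. X \<in> L \<Longrightarrow> f ` X \<in> L"
    and f_E: "\<And>X. X \<in> L \<Longrightarrow> E `` (f ` X) = f ` (E `` X)"
    and meet: "A \<inter> f ` A \<noteq> {}"
  shows "f ` A = A"
proof -
  have fA: "fragment A" and mA: "min_fragment A"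
    using A atom_def min_fragment_def by auto
  have AL: "A \<in> L" "A \<subseteq> V" "A \<noteq> {}" "A \<union> E `` A \<noteq> V"
    using fA fragment_def L_subset by auto
  have inj: "inj_on f V" and surj: "f ` V = V"
    using f by (auto simp: bij_betw_def)
  have sub: "A \<union> E `` A \<subseteq> V"
    using AL E_subset by blast
  have "f ` (A \<union> E `` A) \<noteq> f ` V"
    using inj_on_image_eq_iff[OF inj sub order_refl] AL(4) by simp
  then have "f ` A \<union> E `` (f ` A) \<noteq> V"
    using f_E[OF AL(1)] surj by (simp add: image_Un)
  then have fragment: "fragment (f ` A)"
    unfolding fragment_def using AL f_L by blast
  have "boundary E (f ` A) = f ` boundary E A"
    unfolding boundary_def f_E[OF AL(1)]
    using inj_on_image_set_diff[OF inj, of "E `` A" A] sub by blast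
  then have "card (boundary E (f ` A)) = card (boundary E A)"
    using inj sub by (auto simp: boundary_def intro!: card_image inj_on_subset[OF inj])
  then have "min_fragment (f ` A)"
    using fragment mA unfolding min_fragment_def by simp
  then have "A \<subseteq> f ` A"
    using atom_subset_min_fragment[OF A _ meet] by blast
  moreover have "card (f ` A) = card A"
    by (rule card_image[OF inj_on_subset[OF inj AL(2)]])
  ultimately show ?thesis
    using card_subset_eq[OF fragment_finite[OF fragment], of A] by simp
qed

end

section \<open>Atoms of Cayley digraphs are cosets\<close>

context group
begin

section \<open>Cayley relations on the group and sets invariant under \<open>H\<close>\<close>

definition cayley_rel :: "'a set \<Rightarrow> 'a rel" where
  "cayley_rel T = {(x, y). x \<in> carrier G \<and> y \<in> carrier G \<and> inv x \<otimes> y \<in> T}"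

text \<open>For a subgroup \<open>H\<close> these are the unions of left cosets of
  \<open>H\<close>.\<close>

definition right_invariant :: "'a set \<Rightarrow> 'a set set" where
  "right_invariant H = {F. F \<subseteq> carrier G \<and> (\<forall>x\<in>F. \<forall>h\<in>H. x \<otimes> h \<in> F)}"

text \<open>For a subgroup \<open>H\<close> these are the unions of double cosets of
  \<open>H\<close>. Unlike right invariance, this property is preserved when all elements are
  inverted.\<close>

definition bi_invariant :: "'a set \<Rightarrow> 'a set set" where
  "bi_invariant H = {T. T \<in> right_invariant H \<and> (\<forall>x\<in>T. \<forall>h\<in>H. h \<otimes> x \<in> T)}"

lemma cayley_rel_converse:
  assumes "T \<subseteq> carrier G"
  shows "(cayley_rel T)\<inverse> = cayley_rel (m_inv G ` T)"
proof -
  have "inv y \<otimes> x \<in> T \<longleftrightarrow> inv x \<otimes> y \<in> m_inv G ` T" if "x \<in> carrier G" "y \<in> carrier G" for x y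
  proof
    assume "inv y \<otimes> x \<in> T"
    moreover have "inv x \<otimes> y = inv (inv y \<otimes> x)"
      using that by (simp add: inv_mult_group)
    ultimately show "inv x \<otimes> y \<in> m_inv G ` T" by blast
  next
    assume "inv x \<otimes> y \<in> m_inv G ` T"
    then obtain t where t: "t \<in> T" "inv x \<otimes> y = inv t" by blast
    then have "inv (inv x \<otimes> y) = t" using assms by auto
    then have "inv y \<otimes> x = t" using that by (simp add: inv_mult_group)
    with t show "inv y \<otimes> x \<in> T" by simp
  qed
  then show ?thesis
    unfolding cayley_rel_def by auto
qed

lemma cayley_rel_Image:
  assumes "F \<subseteq> carrier G" "T \<subseteq> carrier G"
  shows "cayley_rel T `` F = F <#> T"
proof
  show "cayley_rel T `` F \<subseteq> F <#> T"
  proof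
    fix y assume "y \<in> cayley_rel T `` F"
    then obtain x where x: "x \<in> F" "x \<in> carrier G" "y \<in> carrier G" "inv x \<otimes> y \<in> T"
      unfolding cayley_rel_def by auto
    then have "y = x \<otimes> (inv x \<otimes> y)"
      by (simp add: m_assoc[symmetric])
    with x show "y \<in> F <#> T"
      unfolding set_mult_def by blast
  qed
  show "F <#> T \<subseteq> cayley_rel T `` F"
  proof
    fix y assume "y \<in> F <#> T"
    then obtain x t where xt: "x \<in> F" "t \<in> T" "y = x \<otimes> t"
      unfolding set_mult_def by blast
    then have "x \<in> carrier G" "t \<in> carrier G" using assms by auto
    with xt have "(x, y) \<in> cayley_rel T"
      unfolding cayley_rel_def by (simp add: m_assoc[symmetric])
    with xt show "y \<in> cayley_rel T `` F" by blast
  qed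
qed

lemma bi_invariant_m_inv:
  assumes H: "subgroup H G" and T: "T \<in> bi_invariant H"
  shows "m_inv G ` T \<in> bi_invariant H"
proof -
  have Tc: "x \<in> carrier G" if "x \<in> T" for x
    using T that unfolding bi_invariant_def right_invariant_def by blast
  have Hc: "h \<in> carrier G" "inv h \<in> H" if "h \<in> H" for h
    using H that by (auto simp: subgroup.mem_carrier subgroup.m_inv_closed)
  have TH: "x \<otimes> h \<in> T" "h \<otimes> x \<in> T" if "x \<in> T" "h \<in> H" for x h
    using T that unfolding bi_invariant_def right_invariant_def by blast+
  have "inv x \<otimes> h \<in> m_inv G ` T" "h \<otimes> inv x \<in> m_inv G ` T" if "x \<in> T" "h \<in> H" for x h
  proof -
    have "inv x \<otimes> h = inv (inv h \<otimes> x)" "h \<otimes> inv x = inv (x \<otimes> inv h)"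
      using that Tc Hc by (simp_all add: inv_mult_group)
    then show "inv x \<otimes> h \<in> m_inv G ` T" "h \<otimes> inv x \<in> m_inv G ` T"
      using TH[OF that(1) Hc(2)[OF that(2)]] by auto
  qed
  then show ?thesis
    unfolding bi_invariant_def right_invariant_def using Tc by blast
qed

lemma cayley_rel_Image_right_invariant:
  assumes H: "subgroup H G" and T: "T \<in> right_invariant H"
  shows "cayley_rel T `` F \<in> right_invariant H"
proof -
  have "y \<otimes> h \<in> cayley_rel T `` F" if "(x, y) \<in> cayley_rel T" "x \<in> F" "h \<in> H" for x y h
  proof -
    have c: "x \<in> carrier G" "y \<in> carrier G" "h \<in> carrier G" "inv x \<otimes> y \<in> T"
      using that H by (auto simp: cayley_rel_def subgroup.mem_carrier)
    then have "inv x \<otimes> (y \<otimes> h) = inv x \<otimes> y \<otimes> h"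
      by (simp add: m_assoc)
    also have "\<dots> \<in> T"
      using T c that unfolding right_invariant_def by blast
    finally have "(x, y \<otimes> h) \<in> cayley_rel T"
      using c by (simp add: cayley_rel_def)
    with that show ?thesis by blast
  qed
  moreover have "cayley_rel T `` F \<subseteq> carrier G"
    by (auto simp: cayley_rel_def)
  ultimately show ?thesis
    unfolding right_invariant_def by blast
qed

text \<open>Images are right multiples by \<open>T\<close>, preimages are right multiples by the
  inverses of \<open>T\<close>; both are unions of left cosets because \<open>T\<close> is invariant
  on both sides.\<close>

lemma cayley_vertex_lattice:
  assumes fin: "finite (carrier G)" and H: "subgroup H G" and T: "T \<in> bi_invariant H"
  shows "vertex_lattice (carrier G) (right_invariant H) (cayley_rel T)"
proof
  show "finite (carrier G)" by fact
  show "F \<in> right_invariant H \<Longrightarrow> F \<subseteq> carrier G" for F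
    by (simp add: right_invariant_def)
  show "cayley_rel T \<subseteq> carrier G \<times> carrier G"
    by (auto simp: cayley_rel_def)
  show "X \<inter> Y \<in> right_invariant H" if "X \<in> right_invariant H" "Y \<in> right_invariant H" for X Y
    using that unfolding right_invariant_def by blast
  show "carrier G - X \<in> right_invariant H" if X: "X \<in> right_invariant H" for X
  proof -
    have False if "x \<in> carrier G" "x \<notin> X" "h \<in> H" "x \<otimes> h \<in> X" for x h
    proof -
      have h: "h \<in> carrier G" "inv h \<in> H"
        using H that by (auto simp: subgroup.mem_carrier subgroup.m_inv_closed)
      then have "x \<otimes> h \<otimes> inv h \<in> X"
        using X that unfolding right_invariant_def by blast
      with that h show False by (simp add: m_assoc)
    qed
    moreover have "x \<otimes> h \<in> carrier G" if "x \<in> carrier G" "h \<in> H" for x h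
      using H that by (simp add: subgroup.mem_carrier)
    ultimately show ?thesis
      unfolding right_invariant_def by blast
  qed
  have Tc: "T \<in> right_invariant H" "T \<subseteq> carrier G"
    using T unfolding bi_invariant_def right_invariant_def by auto
  show "cayley_rel T `` X \<in> right_invariant H" for X
    by (rule cayley_rel_Image_right_invariant[OF H Tc(1)])
  have "m_inv G ` T \<in> right_invariant H"
    using bi_invariant_m_inv[OF H T] unfolding bi_invariant_def by blast
  then show "(cayley_rel T)\<inverse> `` X \<in> right_invariant H" for X
    unfolding cayley_rel_converse[OF Tc(2)] by (rule cayley_rel_Image_right_invariant[OF H])
qed

section \<open>Left translations as automorphisms, and the subgroup obtained from an atom\<close>

lemma cayley_rel_left_translate:
  assumes "g \<in> carrier G" "x \<in> carrier G" "y \<in> carrier G"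
  shows "(g \<otimes> x, g \<otimes> y) \<in> cayley_rel T \<longleftrightarrow> (x, y) \<in> cayley_rel T"
proof -
  have "inv (g \<otimes> x) \<otimes> (g \<otimes> y) = inv x \<otimes> (inv g \<otimes> (g \<otimes> y))"
    using assms by (simp add: inv_mult_group m_assoc)
  also have "\<dots> = inv x \<otimes> y"
    using assms by (simp add: m_assoc[symmetric])
  finally show ?thesis
    using assms by (simp add: cayley_rel_def)
qed

lemma atom_left_translate_eq:
  assumes fin: "finite (carrier G)" and H: "subgroup H G" and T: "T \<in> bi_invariant H"
    and A: "vertex_lattice.atom (carrier G) (right_invariant H) (cayley_rel T) A"
    and g: "g \<in> carrier G" and meet: "A \<inter> (\<otimes>) g ` A \<noteq> {}"
  shows "(\<otimes>) g ` A = A"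
proof -
  interpret vertex_lattice "carrier G" "right_invariant H" "cayley_rel T"
    by (rule cayley_vertex_lattice[OF fin H T])
  have surj: "(\<otimes>) g ` carrier G = carrier G"
    using g by (rule surj_const_mult)
  show ?thesis
  proof (rule atom_image_eq[OF A _ _ _ meet])
    show "bij_betw ((\<otimes>) g) (carrier G) (carrier G)"
      using g surj by (simp add: bij_betw_def inj_on_cmult)
    show "(\<otimes>) g ` X \<in> right_invariant H" if "X \<in> right_invariant H" for X
    proof -
      have "g \<otimes> x \<otimes> h = g \<otimes> (x \<otimes> h)" if "x \<in> carrier G" "h \<in> H" for x h
        using that g H by (simp add: m_assoc subgroup.mem_carrier)
      with that g show ?thesis
        unfolding right_invariant_def by (auto simp: subset_iff)
    qed
    show "cayley_rel T `` ((\<otimes>) g ` X) = (\<otimes>) g ` (cayley_rel T `` X)"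
      if X: "X \<in> right_invariant H" for X
    proof
      have Xc: "X \<subseteq> carrier G" using X by (rule L_subset)
      show "cayley_rel T `` ((\<otimes>) g ` X) \<subseteq> (\<otimes>) g ` (cayley_rel T `` X)"
      proof
        fix y assume "y \<in> cayley_rel T `` ((\<otimes>) g ` X)"
        then obtain x where x: "x \<in> X" "(g \<otimes> x, y) \<in> cayley_rel T" by blast
        then have "y \<in> carrier G" by (simp add: cayley_rel_def)
        then obtain z where z: "z \<in> carrier G" "y = g \<otimes> z"
          using surj by (metis imageE)
        then show "y \<in> (\<otimes>) g ` (cayley_rel T `` X)"
          using x Xc g cayley_rel_left_translate[OF g, of x z] by blast
      qed
      show "(\<otimes>) g ` (cayley_rel T `` X) \<subseteq> cayley_rel T `` ((\<otimes>) g ` X)"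
      proof
        fix y assume "y \<in> (\<otimes>) g ` (cayley_rel T `` X)"
        then obtain x z where xz: "x \<in> X" "(x, z) \<in> cayley_rel T" "y = g \<otimes> z" by blast
        then have "(g \<otimes> x, y) \<in> cayley_rel T"
          using g cayley_rel_left_translate by (auto simp: cayley_rel_def)
        with xz show "y \<in> cayley_rel T `` ((\<otimes>) g ` X)" by blast
      qed
    qed
  qed
qed

text \<open>A block of the left regular action that contains the identity is a subgroup. Translating
  the atom by the inverse of one of its elements produces such a block without changing the size of
  the boundary.\<close>

lemma atom_translate_subgroup:
  assumes fin: "finite (carrier G)" and H: "subgroup H G" and T: "T \<in> bi_invariant H"
    and A: "vertex_lattice.atom (carrier G) (right_invariant H) (cayley_rel T) A"
  obtains K where "subgroup K G" "H \<subseteq> K" "K \<noteq> carrier G"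
    "card (boundary (cayley_rel T) K) \<le> card (boundary (cayley_rel T) A)"
proof -
  interpret vertex_lattice "carrier G" "right_invariant H" "cayley_rel T"
    by (rule cayley_vertex_lattice[OF fin H T])
  have fA: "A \<in> right_invariant H" "A \<noteq> {}" "A \<union> cayley_rel T `` A \<noteq> carrier G"
    using A unfolding atom_def min_fragment_def fragment_def by auto
  then have Ac: "A \<subseteq> carrier G" "A \<noteq> carrier G"
    using L_subset E_subset by blast+
  obtain a where a: "a \<in> A" "a \<in> carrier G" using fA(2) Ac(1) by blast
  \<comment> \<open>\<open>K\<close> is the translate of \<open>A\<close> by
    \<open>inv a\<close>.\<close>
  define K where "K = {g \<in> carrier G. a \<otimes> g \<in> A}"
  \<comment> \<open>Translation by \<open>a \<otimes> k \<otimes> inv a\<close> sends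
    \<open>a\<close> to \<open>a \<otimes> k\<close>, which lies in \<open>A\<close>; hence it maps
    the block \<open>A\<close> to itself.\<close>
  have stab: "(\<otimes>) (a \<otimes> k \<otimes> inv a) ` A = A" if "k \<in> K" for k
  proof (rule atom_left_translate_eq[OF fin H T A])
    have k: "k \<in> carrier G" "a \<otimes> k \<in> A" using that K_def by auto
    then show "a \<otimes> k \<otimes> inv a \<in> carrier G" using a by simp
    have "a \<otimes> k \<otimes> inv a \<otimes> a = a \<otimes> k"
      using a k by (simp add: m_assoc)
    then show "A \<inter> (\<otimes>) (a \<otimes> k \<otimes> inv a) ` A \<noteq> {}"
      using a k by force
  qed
  have "subgroup K G"
  proof
    show "K \<subseteq> carrier G" by (auto simp: K_def)
    show "\<one> \<in> K" using a by (simp add: K_def)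
    show "k \<otimes> l \<in> K" if "k \<in> K" "l \<in> K" for k l
    proof -
      have c: "k \<in> carrier G" "l \<in> carrier G" "a \<otimes> l \<in> A" using that K_def by auto
      have "a \<otimes> k \<otimes> inv a \<otimes> (a \<otimes> l) \<in> A"
        using stab[OF that(1)] c(3) by blast
      moreover have "a \<otimes> k \<otimes> inv a \<otimes> (a \<otimes> l) = a \<otimes> k \<otimes> (inv a \<otimes> a) \<otimes> l"
        using a c by (simp only: m_assoc m_closed inv_closed)
      ultimately show ?thesis
        using a c by (simp add: K_def m_assoc)
    qed
    show "inv k \<in> K" if "k \<in> K" for k
    proof -
      have c: "k \<in> carrier G" using that K_def by auto
      \<comment> \<open>The stabilizing translation is onto \<open>A\<close>, so \<open>a\<close>
        has a preimage \<open>x\<close> there; solving for it gives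
        \<open>x = a \<otimes> inv k\<close>.\<close>
      obtain x where x: "x \<in> A" "a = a \<otimes> k \<otimes> inv a \<otimes> x"
        using stab[OF \<open>k \<in> K\<close>] a by (metis imageE)
      then have xc: "x \<in> carrier G" using Ac by blast
      have "a \<otimes> k \<otimes> inv a \<otimes> x = a \<otimes> (k \<otimes> (inv a \<otimes> x))"
        using a c xc by (simp add: m_assoc)
      with x(2) have "a = a \<otimes> (k \<otimes> (inv a \<otimes> x))"
        by (rule trans)
      then have "k \<otimes> (inv a \<otimes> x) = \<one>"
        using a c xc by (subst (asm) l_cancel_one') auto
      then have "inv (inv a \<otimes> x) = k"
        using a c xc by (intro inv_equality) auto
      then have "inv k = inv a \<otimes> x"
        using a xc by auto
      then have "a \<otimes> inv k = x"
        using a xc by (simp add: m_assoc[symmetric])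
      then show ?thesis using x(1) c by (simp add: K_def)
    qed
  qed
  moreover have "H \<subseteq> K"
    using fA(1) a H by (auto simp: K_def right_invariant_def subgroup.mem_carrier)
  moreover have "K \<noteq> carrier G"
  proof
    assume "K = carrier G"
    then have "(\<otimes>) a ` carrier G \<subseteq> A" by (auto simp: K_def)
    then show False using surj_const_mult[OF a(2)] Ac by auto
  qed
  moreover have "card (boundary (cayley_rel T) K) \<le> card (boundary (cayley_rel T) A)"
  proof (rule card_inj_on_le[where f = "(\<otimes>) a"])
    have "boundary (cayley_rel T) K \<subseteq> carrier G"
      using E_subset by (auto simp: boundary_def)
    then show "inj_on ((\<otimes>) a) (boundary (cayley_rel T) K)"
      using inj_on_cmult[OF a(2)] inj_on_subset by blast
    show "finite (boundary (cayley_rel T) A)"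
      by (rule finite_boundary)
    show "(\<otimes>) a ` boundary (cayley_rel T) K \<subseteq> boundary (cayley_rel T) A"
    proof
      fix y assume "y \<in> (\<otimes>) a ` boundary (cayley_rel T) K"
      then obtain k x where kx: "k \<in> K" "(k, x) \<in> cayley_rel T" "x \<notin> K" "y = a \<otimes> x"
        unfolding boundary_def by blast
      then have c: "k \<in> carrier G" "x \<in> carrier G" "a \<otimes> k \<in> A"
        by (auto simp: K_def cayley_rel_def)
      then have "(a \<otimes> k, y) \<in> cayley_rel T"
        using kx a cayley_rel_left_translate by simp
      moreover have "y \<notin> A" using kx c by (simp add: K_def)
      ultimately show "y \<in> boundary (cayley_rel T) A"
        unfolding boundary_def using c(3) by blast
    qed
  qed
  ultimately show thesis using that by blast
qed

text \<open>A smallest atom may belong to the relation or to its reversal. The reversal is the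
  Cayley relation of the inverses, which accounts for the two choices of \<open>T'\<close>.\<close>

theorem subgroup_boundary_le:
  assumes fin: "finite (carrier G)" and H: "subgroup H G" and T: "T \<in> bi_invariant H"
    and F: "F \<in> right_invariant H" "F \<noteq> {}" "F \<union> (F <#> T) \<noteq> carrier G"
  obtains K T' where "subgroup K G" "H \<subseteq> K" "K \<noteq> carrier G" "T' = T \<or> T' = m_inv G ` T"
    "card ((K <#> T') - K) \<le> card ((F <#> T) - F)"
proof -
  interpret vertex_lattice "carrier G" "right_invariant H" "cayley_rel T"
    by (rule cayley_vertex_lattice[OF fin H T])
  have Tc: "T \<subseteq> carrier G" and Fc: "F \<subseteq> carrier G"
    using T F unfolding bi_invariant_def right_invariant_def by auto
  have Tc': "m_inv G ` T \<subseteq> carrier G" using Tc by auto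
  have F_im: "cayley_rel T `` F = F <#> T"
    by (rule cayley_rel_Image[OF Fc Tc])
  then have "fragment F"
    using F by (simp add: fragment_def)
  then show thesis
  proof (cases rule: atom_exists)
    case (1 A)
    obtain K where K: "subgroup K G" "H \<subseteq> K" "K \<noteq> carrier G"
      "card (boundary (cayley_rel T) K) \<le> card (boundary (cayley_rel T) A)"
      using atom_translate_subgroup[OF fin H T 1(1)] .
    then have "card ((K <#> T) - K) \<le> card ((F <#> T) - F)"
      using 1(2) F_im cayley_rel_Image[OF subgroup.subset[OF K(1)] Tc]
      by (simp add: boundary_def)
    with K that show thesis by blast
  next
    case (2 A)
    obtain K where K: "subgroup K G" "H \<subseteq> K" "K \<noteq> carrier G"
      "card (boundary (cayley_rel (m_inv G ` T)) K) \<le> card (boundary (cayley_rel (m_inv G ` T)) A)"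
      using atom_translate_subgroup[OF fin H bi_invariant_m_inv[OF H T]] 2(1)
      unfolding cayley_rel_converse[OF Tc] by blast
    then have "card ((K <#> m_inv G ` T) - K) \<le> card ((F <#> T) - F)"
      using 2(2) F_im cayley_rel_Image[OF subgroup.subset[OF K(1)] Tc']
      unfolding cayley_rel_converse[OF Tc] by (simp add: boundary_def)
    with K that show thesis by blast
  qed
qed

end

section \<open>Boundaries of subgroups in a hierarchical chain\<close>

text \<open>\<open>X\<close> and its translate lie in the distinct left cosets \<open>M\<close> and
  \<open>g <# M\<close>.\<close>

lemma (in group) card_Un_left_translate:
  assumes "subgroup M G" "finite X" "X \<subseteq> M" "g \<in> carrier G" "g \<notin> M"
  shows "card (X \<union> (\<otimes>) g ` X) = 2 * card X"
proof -
  have Mc: "M \<subseteq> carrier G" using assms(1) by (rule subgroup.subset)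
  have "X \<inter> (\<otimes>) g ` X = {}"
  proof (rule ccontr)
    assume "X \<inter> (\<otimes>) g ` X \<noteq> {}"
    then obtain y where y: "y \<in> X" "g \<otimes> y \<in> X" by blast
    then have "g \<otimes> y \<otimes> inv y \<in> M"
      using assms(1,3) by (meson subgroup.m_closed subgroup.m_inv_closed subsetD)
    moreover have "g \<otimes> y \<otimes> inv y = g"
      using y assms(3,4) Mc by (simp add: m_assoc subset_iff)
    ultimately show False using assms(5) by simp
  qed
  moreover have "card ((\<otimes>) g ` X) = card X"
    using assms Mc by (intro card_image inj_on_subset[OF inj_on_cmult]) auto
  ultimately show ?thesis
    using assms(2) by (simp add: card_Un_disjoint)
qed

section \<open>Double cosets and inversion\<close>

lemma mem_rcoset_mult_iff:
  "y \<in> (K #>\<^bsub>G\<^esub> x) <#>\<^bsub>G\<^esub> H \<longleftrightarrow> (\<exists>k\<in>K. \<exists>h\<in>H. y = k \<otimes>\<^bsub>G\<^esub> x \<otimes>\<^bsub>G\<^esub> h)"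
  unfolding r_coset_def set_mult_def by auto

lemma (in group) double_coset_subset_carrier:
  assumes "subgroup H G" "x \<in> carrier G"
  shows "double_coset G H x \<subseteq> carrier G"
  using assms by (auto simp: double_coset_def mem_rcoset_mult_iff subgroup.mem_carrier)

lemma (in group) double_coset_inv:
  assumes "subgroup H G" "x \<in> carrier G"
  shows "double_coset G H (inv x) = m_inv G ` double_coset G H x"
proof -
  have inv_eq: "inv (h \<otimes> z \<otimes> l) = inv l \<otimes> inv z \<otimes> inv h"
    if "h \<in> H" "l \<in> H" "z \<in> carrier G" for h l z
    using that assms(1) by (simp add: inv_mult_group m_assoc subgroup.mem_carrier)
  have Hinv: "inv h \<in> H" "inv (inv h) = h" if "h \<in> H" for h
    using that assms(1) by (auto simp: subgroup.m_inv_closed subgroup.mem_carrier)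
  show ?thesis
  proof
    show "double_coset G H (inv x) \<subseteq> m_inv G ` double_coset G H x"
    proof
      fix y assume "y \<in> double_coset G H (inv x)"
      then obtain h l where hl: "h \<in> H" "l \<in> H" "y = h \<otimes> inv x \<otimes> l"
        unfolding double_coset_def mem_rcoset_mult_iff by blast
      then have "y = inv (inv l \<otimes> x \<otimes> inv h)"
        using inv_eq[of "inv l" "inv h" x] Hinv assms(2) by simp
      then show "y \<in> m_inv G ` double_coset G H x"
        unfolding double_coset_def using hl Hinv by (blast intro: mem_rcoset_mult_iff[THEN iffD2])
    qed
    show "m_inv G ` double_coset G H x \<subseteq> double_coset G H (inv x)"
    proof
      fix y assume "y \<in> m_inv G ` double_coset G H x"
      then obtain h l where hl: "h \<in> H" "l \<in> H" "y = inv (h \<otimes> x \<otimes> l)"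
        unfolding double_coset_def image_iff Bex_def mem_rcoset_mult_iff by blast
      then have "y = inv l \<otimes> inv x \<otimes> inv h"
        using inv_eq assms(2) by simp
      then show "y \<in> double_coset G H (inv x)"
        unfolding double_coset_def mem_rcoset_mult_iff using hl Hinv by blast
    qed
  qed
qed

lemma (in group) card_double_coset_inv:
  assumes "subgroup H G" "x \<in> carrier G"
  shows "card (double_coset G H (inv x)) = card (double_coset G H x)"
  unfolding double_coset_inv[OF assms]
  using double_coset_subset_carrier[OF assms]
  by (intro card_image inj_on_subset[OF inv_inj])

text \<open>Degrees and indices appear multiplied by the order of \<open>H\<close>, as cardinalities
  of subsets of the group. A locale is used so that it can be instantiated again with the inverted
  generators. Distinctness of the chain enters through \<open>s_notin\<close>.\<close>

locale coset_chain = group G for G (structure) +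
  fixes H :: "'a set" and s :: "nat \<Rightarrow> 'a" and k :: nat
  assumes fin: "finite (carrier G)"
    and H: "subgroup H G"
    and s_carrier: "i \<in> {1..k} \<Longrightarrow> s i \<in> carrier G"
    and s_notin: "1 \<le> i \<Longrightarrow> i < k \<Longrightarrow> s (Suc i) \<notin> gen_chain G H s i"
    and card_double_coset_le: "1 \<le> i \<Longrightarrow> i < k \<Longrightarrow>
          card (double_coset G H (s (Suc i))) \<le> (\<Sum>j = 1..i. card (double_coset G H (s j)))"
    and card_chain_1: "2 \<le> k \<Longrightarrow>
          (\<Sum>j = 1..2. card (double_coset G H (s j))) \<le> card (gen_chain G H s 1)"
begin

section \<open>Growth of the chain of generated subgroups\<close>

lemma generators_subset: "i \<le> k \<Longrightarrow> H \<union> s ` {1..i} \<subseteq> carrier G"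
  using s_carrier subgroup.subset[OF H] by fastforce

lemma chain_subgroup: "i \<le> k \<Longrightarrow> subgroup (gen_chain G H s i) G"
  unfolding gen_chain_def using generators_subset by (rule generate_is_subgroup)

lemma chain_generators: "H \<union> s ` {1..i} \<subseteq> gen_chain G H s i"
  unfolding gen_chain_def by (auto intro: generate.incl)

lemma chain_finite: "i \<le> k \<Longrightarrow> finite (gen_chain G H s i)"
  using chain_subgroup fin subgroup.subset finite_subset by metis

lemma chain_subset:
  "subgroup K G \<Longrightarrow> H \<union> s ` {1..i} \<subseteq> K \<Longrightarrow> gen_chain G H s i \<subseteq> K"
  unfolding gen_chain_def using generate_subgroup_incl by blast

lemma chain_Suc: "gen_chain G H s i \<subseteq> gen_chain G H s (Suc i)"
  unfolding gen_chain_def by (intro mono_generate) auto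

text \<open>One step along the chain at most doubles the partial sum of the double coset sizes,
  since the new term is at most the old sum, and at least doubles the order of the subgroup. The
  start is \<open>card_chain_1\<close>.\<close>

lemma sum_le_card_chain:
  assumes "1 \<le> i" "i < k"
  shows "(\<Sum>j = 1..Suc i. card (double_coset G H (s j))) \<le> card (gen_chain G H s i)"
  using assms
proof (induction i rule: nat_induct_at_least)
  case base
  then show ?case using card_chain_1 by (simp add: numeral_2_eq_2)
next
  case (Suc i)
  let ?M = "gen_chain G H s i" and ?N = "gen_chain G H s (Suc i)"
  have g: "s (Suc i) \<in> ?N" "s (Suc i) \<in> carrier G"
    using chain_generators[of "Suc i"] s_carrier[of "Suc i"] Suc.prems by auto
  have N: "subgroup ?N G" using chain_subgroup Suc.prems by simp
  have "(\<otimes>) (s (Suc i)) ` ?M \<subseteq> ?N"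
    using chain_Suc g N by (auto intro: subgroup.m_closed)
  \<comment> \<open>The new generator lies outside \<open>?M\<close>, so two disjoint left cosets of
    \<open>?M\<close> fit into \<open>?N\<close>.\<close>
  then have "?M \<union> (\<otimes>) (s (Suc i)) ` ?M \<subseteq> ?N"
    using chain_Suc by blast
  then have "card (?M \<union> (\<otimes>) (s (Suc i)) ` ?M) \<le> card ?N"
    using chain_finite Suc.prems by (intro card_mono) auto
  moreover have "card (?M \<union> (\<otimes>) (s (Suc i)) ` ?M) = 2 * card ?M"
    using Suc.hyps Suc.prems g s_notin chain_subgroup chain_finite
    by (intro card_Un_left_translate[of ?M]) auto
  moreover have "(\<Sum>j = 1..Suc i. card (double_coset G H (s j))) \<le> card ?M"
    using Suc by simp
  moreover have "card (double_coset G H (s (Suc (Suc i))))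
      \<le> (\<Sum>j = 1..Suc i. card (double_coset G H (s j)))"
    using card_double_coset_le[of "Suc i"] Suc.prems by simp
  ultimately show ?case
    by (simp only: sum.cl_ivl_Suc) simp
qed

text \<open>This is the set \<open>W\<close> of the overview. When \<open>K\<close> is a subgroup
  containing \<open>H\<close>, it is disjoint from \<open>K\<close> and thus part of the boundary of
  \<open>K\<close>.\<close>

definition outer :: "'a set \<Rightarrow> nat \<Rightarrow> 'a set" where
  "outer K n = (\<Union>j \<in> {j \<in> {1..n}. s j \<notin> K}. (K #> s j) <#> H)"

lemma mem_outer_iff:
  "y \<in> outer K n \<longleftrightarrow>
     (\<exists>j\<in>{1..n}. s j \<notin> K \<and> (\<exists>g\<in>K. \<exists>h\<in>H. y = g \<otimes> s j \<otimes> h))"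
  unfolding outer_def UN_iff mem_rcoset_mult_iff by blast

lemma outer_subset:
  assumes "n \<le> k" "subgroup M G" "K \<subseteq> M" "H \<union> s ` {1..n} \<subseteq> M"
  shows "outer K n \<subseteq> M"
proof
  fix y assume "y \<in> outer K n"
  then obtain j g h where "j \<in> {1..n}" "g \<in> K" "h \<in> H" "y = g \<otimes> s j \<otimes> h"
    unfolding mem_outer_iff by blast
  then show "y \<in> M"
    using assms by (auto intro!: subgroup.m_closed[OF assms(2)])
qed

lemma outer_finite:
  assumes "n \<le> k" "subgroup K G"
  shows "finite (outer K n)"
  using outer_subset[OF assms(1) subgroup_self] generators_subset[OF assms(1)]
    subgroup.subset[OF assms(2)] fin finite_subset by metis

lemma double_coset_subset_outer:
  assumes "H \<subseteq> K" "j \<in> {1..n}" "s j \<notin> K"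
  shows "double_coset G H (s j) \<subseteq> outer K n"
  using assms unfolding double_coset_def subset_iff mem_outer_iff mem_rcoset_mult_iff by blast

text \<open>\<open>K\<close> stays arbitrary in the induction because the hypothesis is applied to
  its intersection with the previous chain subgroup.\<close>

lemma sum_le_card_outer:
  assumes "1 \<le> n" "n \<le> k" "subgroup K G" "H \<subseteq> K" "K \<subset> gen_chain G H s n"
  shows "(\<Sum>j = 1..n. card (double_coset G H (s j))) \<le> card (outer K n)"
  using assms
proof (induction n arbitrary: K rule: nat_induct_at_least)
  \<comment> \<open>If \<open>s 1\<close> were in \<open>K\<close>, then \<open>K\<close> would
    contain the whole first chain subgroup.\<close>
  case base
  then have "s 1 \<notin> K"
    using chain_subset[of K 1] by auto
  then have "double_coset G H (s 1) \<subseteq> outer K 1"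
    using base by (intro double_coset_subset_outer) auto
  then show ?case
    using outer_finite[of 1 K] base by (simp add: card_mono)
next
  case (Suc n)
  let ?M = "gen_chain G H s n" and ?g = "s (Suc n)"
  let ?S = "\<lambda>n. \<Sum>j = 1..n. card (double_coset G H (s j))"
  define L where "L = K \<inter> ?M"
  have nk: "n < k" "n \<le> k" "Suc n \<le> k" using Suc.prems by auto
  have M: "subgroup ?M G" "H \<union> s ` {1..n} \<subseteq> ?M" "finite ?M"
    using chain_subgroup chain_generators chain_finite nk by auto
  have L: "subgroup L G" "H \<subseteq> L" "L \<subseteq> ?M" "L \<subseteq> K"
    using subgroups_Inter_pair[OF Suc.prems(2) M(1)] Suc.prems M by (auto simp: L_def)
  have g: "?g \<in> carrier G" "?g \<notin> ?M"
    using s_carrier s_notin nk Suc.hyps by auto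
  have finO: "finite (outer K (Suc n))"
    using outer_finite nk Suc.prems by blast
  \<comment> \<open>The first \<open>n\<close> generators lie in \<open>?M\<close>, so
    \<open>L\<close> and \<open>K\<close> exclude the same ones among them. This is what places
    \<open>outer L n\<close> inside \<open>outer K (Suc n)\<close>.\<close>
  have s_L: "s j \<notin> L \<longleftrightarrow> s j \<notin> K" if "j \<in> {1..n}" for j
    using that M(2) unfolding L_def by blast
  have sub: "outer L n \<subseteq> outer K (Suc n)"
    using L(4) s_L by (fastforce simp: mem_outer_iff)
  have OL: "outer L n \<subseteq> ?M"
    using outer_subset[OF nk(2) M(1) L(3) M(2)] .
  have S_Suc: "?S (Suc n) = ?S n + card (double_coset G H ?g)"
    by simp
  show ?case
  proof (cases "L = ?M")
    case True
    then have MK: "?M \<subseteq> K" using L(4) by simp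
    have gK: "?g \<notin> K"
    proof
      assume "?g \<in> K"
      then have "gen_chain G H s (Suc n) \<subseteq> K"
        using chain_subset[OF Suc.prems(2), of "Suc n"] M(2) MK by (auto simp: atLeastAtMostSuc_conv)
      then show False using Suc.prems by blast
    qed
    have Kc: "K \<subseteq> carrier G" using Suc.prems(2) by (rule subgroup.subset)
    \<comment> \<open>The right coset of \<open>K\<close> through \<open>?g\<close> has the size of
      \<open>K\<close>, hence at least that of \<open>?M\<close>, and this already dominates the sum
      for \<open>Suc n\<close>.\<close>
    have "(\<lambda>x. x \<otimes> ?g) ` K \<subseteq> outer K (Suc n)"
    proof
      fix y assume "y \<in> (\<lambda>x. x \<otimes> ?g) ` K"
      then obtain x where x: "x \<in> K" "y = x \<otimes> ?g" by blast
      then have "y = x \<otimes> ?g \<otimes> \<one>" using g(1) Kc by auto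
      then show "y \<in> outer K (Suc n)"
        unfolding mem_outer_iff using x gK subgroup.one_closed[OF H] by fastforce
    qed
    then have "card ((\<lambda>x. x \<otimes> ?g) ` K) \<le> card (outer K (Suc n))"
      by (rule card_mono[OF finO])
    moreover have "card ((\<lambda>x. x \<otimes> ?g) ` K) = card K"
      using inj_on_multc[OF g(1)] Kc by (intro card_image) (rule inj_on_subset)
    moreover have "card ?M \<le> card K"
      using MK Kc fin finite_subset by (intro card_mono) auto
    moreover have "?S (Suc n) \<le> card ?M"
      using sum_le_card_chain[OF Suc.hyps nk(1)] .
    ultimately show ?thesis by linarith
  next
    case False
    then have IH: "?S n \<le> card (outer L n)"
      using Suc.IH[OF nk(2) L(1,2)] L(3) by blast
    show ?thesis
    proof (cases "?g \<in> K")
      case True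
      \<comment> \<open>Left multiplication by \<open>?g\<close> stays inside
        \<open>outer K (Suc n)\<close> because \<open>?g\<close> and \<open>L\<close> are contained
        in \<open>K\<close>. The translate is disjoint from \<open>outer L n\<close>, which lies in
        \<open>?M\<close> while \<open>?g\<close> does not, and twice the sum for \<open>n\<close>
        covers the sum for \<open>Suc n\<close>.\<close>
      have "(\<otimes>) ?g ` outer L n \<subseteq> outer K (Suc n)"
      proof
        fix y assume "y \<in> (\<otimes>) ?g ` outer L n"
        then obtain j x h where j: "j \<in> {1..n}" "s j \<notin> L" "x \<in> L" "h \<in> H"
          and y: "y = ?g \<otimes> (x \<otimes> s j \<otimes> h)"
          unfolding image_iff Bex_def mem_outer_iff by blast
        have "x \<in> carrier G" "h \<in> carrier G" "s j \<in> carrier G"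
          using j L(1) H s_carrier[of j] nk by (auto simp: subgroup.mem_carrier)
        then have "y = ?g \<otimes> x \<otimes> s j \<otimes> h"
          using y g(1) by (simp add: m_assoc)
        moreover have "?g \<otimes> x \<in> K"
          using True j(3) L(4) Suc.prems(2) by (meson subgroup.m_closed subsetD)
        ultimately show "y \<in> outer K (Suc n)"
          unfolding mem_outer_iff using j s_L by fastforce
      qed
      then have "card (outer L n \<union> (\<otimes>) ?g ` outer L n) \<le> card (outer K (Suc n))"
        using sub finO by (intro card_mono) auto
      moreover have "card (outer L n \<union> (\<otimes>) ?g ` outer L n) = 2 * card (outer L n)"
        using M OL g finite_subset by (intro card_Un_left_translate[of ?M]) auto
      moreover have "card (double_coset G H ?g) \<le> ?S n"
        using card_double_coset_le[OF Suc.hyps nk(1)] .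
      ultimately show ?thesis
        unfolding S_Suc using IH by linarith
    next
      case False
      have "double_coset G H ?g \<subseteq> outer K (Suc n)"
        using Suc.prems False by (intro double_coset_subset_outer) auto
      then have "card (outer L n \<union> double_coset G H ?g) \<le> card (outer K (Suc n))"
        using sub finO by (intro card_mono) auto
      moreover have "card (outer L n \<union> double_coset G H ?g)
          = card (outer L n) + card (double_coset G H ?g)"
      proof (rule card_Un_disjoint)
        show "finite (outer L n)" using OL M(3) finite_subset by blast
        show "finite (double_coset G H ?g)"
          using double_coset_subset_carrier[OF H g(1)] fin finite_subset by blast
        \<comment> \<open>\<open>outer L n\<close> lies in \<open>?M\<close>, but an element of
          \<open>?M\<close> in the double coset of \<open>?g\<close> would put \<open>?g\<close>
          itself into \<open>?M\<close>, since \<open>H\<close> is contained in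
          \<open>?M\<close>.\<close>
        have False if "y \<in> ?M" "y \<in> double_coset G H ?g" for y
        proof -
          obtain h l where hl: "h \<in> H" "l \<in> H" "y = h \<otimes> ?g \<otimes> l"
            using \<open>y \<in> double_coset G H ?g\<close> unfolding double_coset_def mem_rcoset_mult_iff by blast
          have c: "h \<in> carrier G" "l \<in> carrier G"
            using hl H by (auto simp: subgroup.mem_carrier)
          have "inv h \<otimes> (y \<otimes> inv l) \<in> ?M"
            using hl that M(1,2) by (auto intro!: subgroup.m_closed[OF M(1)] subgroup.m_inv_closed[OF M(1)])
          moreover have "y \<otimes> inv l = h \<otimes> ?g"
            using hl c g(1) by (simp add: m_assoc)
          moreover have "inv h \<otimes> (h \<otimes> ?g) = ?g"
            using c g(1) by (simp add: m_assoc[symmetric])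
          ultimately show False using g(2) by simp
        qed
        then show "outer L n \<inter> double_coset G H ?g = {}"
          using OL by blast
      qed
      ultimately show ?thesis
        unfolding S_Suc using IH by linarith
    qed
  qed
qed

lemma sum_le_card_boundary:
  assumes "1 \<le> k" "gen_chain G H s k = carrier G"
    and K: "subgroup K G" "H \<subseteq> K" "K \<noteq> carrier G"
  shows "(\<Sum>j = 1..k. card (double_coset G H (s j)))
           \<le> card ((K <#> (\<Union>j\<in>{1..k}. double_coset G H (s j))) - K)"
proof -
  let ?T = "\<Union>j\<in>{1..k}. double_coset G H (s j)"
  have Kc: "K \<subseteq> carrier G" using K(1) by (rule subgroup.subset)
  \<comment> \<open>An element of \<open>K\<close> of the form
    \<open>x \<otimes> s j \<otimes> h\<close> with \<open>x \<in> K\<close> and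
    \<open>h \<in> H\<close> would force \<open>s j \<in> K\<close>.\<close>
  have "outer K k \<subseteq> (K <#> ?T) - K"
  proof
    fix y assume "y \<in> outer K k"
    then obtain j x h where j: "j \<in> {1..k}" "s j \<notin> K" "x \<in> K" "h \<in> H" "y = x \<otimes> s j \<otimes> h"
      unfolding mem_outer_iff by blast
    have c: "x \<in> carrier G" "h \<in> carrier G" "s j \<in> carrier G"
      using j Kc H s_carrier by (auto simp: subgroup.mem_carrier)
    have "\<one> \<otimes> s j \<otimes> h \<in> double_coset G H (s j)"
      unfolding double_coset_def mem_rcoset_mult_iff using j subgroup.one_closed[OF H] by blast
    moreover have "y = x \<otimes> (\<one> \<otimes> s j \<otimes> h)"
      using j c by (simp add: m_assoc)
    ultimately have "y \<in> K <#> ?T"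
      unfolding set_mult_def using j by blast
    moreover have "y \<notin> K"
    proof
      assume "y \<in> K"
      then have "inv x \<otimes> (y \<otimes> inv h) \<in> K"
        using j K by (auto intro!: subgroup.m_closed[OF K(1)] subgroup.m_inv_closed[OF K(1)])
      moreover have "y \<otimes> inv h = x \<otimes> s j"
        using j c by (simp add: m_assoc)
      moreover have "inv x \<otimes> (x \<otimes> s j) = s j"
        using c by (simp add: m_assoc[symmetric])
      ultimately show False using j by simp
    qed
    ultimately show "y \<in> (K <#> ?T) - K" by blast
  qed
  moreover have "finite ((K <#> ?T) - K)"
  proof -
    have "?T \<subseteq> carrier G"
      using double_coset_subset_carrier[OF H s_carrier] by blast
    then show ?thesis
      using set_mult_closed[OF Kc] fin finite_subset by (metis finite_Diff)
  qed
  ultimately have "card (outer K k) \<le> card ((K <#> ?T) - K)"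
    by (intro card_mono)
  then show ?thesis
    using sum_le_card_outer[OF assms(1) order_refl K(1,2)] assms Kc by fastforce
qed

section \<open>Invariance of the hypotheses under inverting the generators\<close>

lemma gen_chain_inv:
  assumes "i \<le> k"
  shows "gen_chain G H (\<lambda>j. inv (s j)) i = gen_chain G H s i"
proof
  have c: "s j \<in> carrier G" if "j \<in> {1..i}" for j
    using s_carrier that assms by simp
  have sub: "H \<union> (\<lambda>j. inv (s j)) ` {1..i} \<subseteq> carrier G"
    using c subgroup.subset[OF H] by auto
  let ?N = "generate G (H \<union> (\<lambda>j. inv (s j)) ` {1..i})"
  have N: "subgroup ?N G" using sub by (rule generate_is_subgroup)
  have "inv (s j) \<in> gen_chain G H s i" if "j \<in> {1..i}" for j
    using chain_generators[of i] that subgroup.m_inv_closed[OF chain_subgroup[OF assms]] by blast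
  then show "gen_chain G H (\<lambda>j. inv (s j)) i \<subseteq> gen_chain G H s i"
    unfolding gen_chain_def[of G H "\<lambda>j. inv (s j)"]
    using chain_generators[of i] by (intro generate_subgroup_incl chain_subgroup[OF assms]) auto
  have "s j \<in> ?N" if "j \<in> {1..i}" for j
  proof -
    have "inv (s j) \<in> ?N" using that by (auto intro: generate.incl)
    then have "inv (inv (s j)) \<in> ?N" by (rule subgroup.m_inv_closed[OF N])
    then show ?thesis using c[OF that] by simp
  qed
  then have "H \<union> s ` {1..i} \<subseteq> ?N" by (auto intro: generate.incl)
  then show "gen_chain G H s i \<subseteq> gen_chain G H (\<lambda>j. inv (s j)) i"
    using chain_subset[OF N] unfolding gen_chain_def[of G H "\<lambda>j. inv (s j)"] by blast
qed

text \<open>Inversion maps double cosets bijectively to double cosets and does not change the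
  generated subgroups. The boundary estimate therefore also holds for the reversed digraph.\<close>

lemma coset_chain_inv: "coset_chain G H (\<lambda>j. inv (s j)) k"
proof (intro coset_chain.intro coset_chain_axioms.intro)
  have card_eq: "card (double_coset G H (inv (s j))) = card (double_coset G H (s j))"
    if "j \<in> {1..k}" for j
    using card_double_coset_inv[OF H s_carrier[OF that]] .
  then have sum_eq: "(\<Sum>j = 1..i. card (double_coset G H (inv (s j))))
      = (\<Sum>j = 1..i. card (double_coset G H (s j)))" if "i \<le> k" for i
    using that by (intro sum.cong) auto
  show "group G" "finite (carrier G)" "subgroup H G"
    by (rule group_axioms, rule fin, rule H)
  show "inv (s i) \<in> carrier G" if "i \<in> {1..k}" for i
    using s_carrier[OF that] by simp
  show "inv (s (Suc i)) \<notin> gen_chain G H (\<lambda>j. inv (s j)) i" if "1 \<le> i" "i < k" for i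
  proof
    assume "inv (s (Suc i)) \<in> gen_chain G H (\<lambda>j. inv (s j)) i"
    then have "inv (inv (s (Suc i))) \<in> gen_chain G H s i"
      using gen_chain_inv[of i] that subgroup.m_inv_closed[OF chain_subgroup, of i] by auto
    then show False using s_notin[OF that] s_carrier[of "Suc i"] that by simp
  qed
  show "card (double_coset G H (inv (s (Suc i))))
      \<le> (\<Sum>j = 1..i. card (double_coset G H (inv (s j))))" if "1 \<le> i" "i < k" for i
    using card_double_coset_le[OF that] card_eq[of "Suc i"] sum_eq[of i] that by simp
  show "(\<Sum>j = 1..2. card (double_coset G H (inv (s j))))
      \<le> card (gen_chain G H (\<lambda>j. inv (s j)) 1)" if "2 \<le> k"
    using card_chain_1[OF that] sum_eq[OF that] gen_chain_inv[of 1] that by simp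
qed

end

section \<open>Connectivity of coset digraphs\<close>

context group
begin

section \<open>Passing between numbers of cosets and numbers of group elements\<close>

lemma card_Union_lcosets:
  assumes fin: "finite (carrier G)" and H: "subgroup H G" and X: "X \<subseteq> lcosets H"
  shows "card (\<Union>X) = card H * card X"
proof -
  have "\<Union>X \<subseteq> carrier G"
    using X lcosets_part_G[OF H] by blast
  then have "finite (\<Union>X)"
    using fin finite_subset by blast
  then have "card H * card X = card (\<Union>X)"
    using X l_card_cosets_equal[OF _ subgroup.subset[OF H] fin] lcos_disjoint[OF H]
    by (intro card_partition) (auto simp: finite_UnionD subset_iff)
  then show ?thesis by simp
qed

lemma lcoset_subset_right_invariant:
  assumes "F \<in> right_invariant H" "x \<in> F"
  shows "x <# H \<subseteq> F"
  using assms by (auto simp: right_invariant_def l_coset_def)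

lemma Union_lcosets_right_invariant:
  assumes H: "subgroup H G" and F: "F \<in> right_invariant H"
  shows "\<Union>{C \<in> lcosets H. C \<subseteq> F} = F"
proof -
  have "x \<in> x <# H" "x <# H \<subseteq> F" "x <# H \<in> lcosets H" if "x \<in> F" for x
  proof -
    have x: "x \<in> carrier G" using F that by (auto simp: right_invariant_def)
    then show "x \<in> x <# H" using lcos_self H by blast
    show "x <# H \<subseteq> F" using lcoset_subset_right_invariant[OF F that] .
    show "x <# H \<in> lcosets H" using x by (auto simp: LCOSETS_def)
  qed
  then show ?thesis by blast
qed

lemma lcoset_right_invariant:
  assumes H: "subgroup H G" and C: "C \<in> lcosets H"
  shows "C \<in> right_invariant H"
proof -
  obtain x where x: "x \<in> carrier G" "C = x <# H"
    using C by (auto simp: LCOSETS_def)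
  have "x \<otimes> h \<otimes> l \<in> x <# H" if "h \<in> H" "l \<in> H" for h l
  proof -
    have "x \<otimes> h \<otimes> l = x \<otimes> (h \<otimes> l)"
      using that x H by (simp add: m_assoc subgroup.mem_carrier)
    moreover have "h \<otimes> l \<in> H" using that H by (simp add: subgroup.m_closed)
    ultimately show ?thesis by (auto simp: l_coset_def)
  qed
  moreover have "C \<subseteq> carrier G"
    using C lcosets_part_G[OF H] by blast
  ultimately show ?thesis
    unfolding right_invariant_def x(2) by (auto simp: l_coset_def)
qed

lemma double_coset_bi_invariant:
  assumes H: "subgroup H G" and x: "x \<in> carrier G"
  shows "double_coset G H x \<in> bi_invariant H"
proof -
  have "h \<otimes> x \<otimes> l \<otimes> m \<in> double_coset G H x" "m \<otimes> (h \<otimes> x \<otimes> l) \<in> double_coset G H x"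
    if "h \<in> H" "l \<in> H" "m \<in> H" for h l m
  proof -
    have "h \<otimes> x \<otimes> l \<otimes> m = h \<otimes> x \<otimes> (l \<otimes> m)" "m \<otimes> (h \<otimes> x \<otimes> l) = m \<otimes> h \<otimes> x \<otimes> l"
      using that x H by (simp_all add: m_assoc subgroup.mem_carrier)
    moreover have "l \<otimes> m \<in> H" "m \<otimes> h \<in> H"
      using that H by (auto intro: subgroup.m_closed)
    ultimately show "h \<otimes> x \<otimes> l \<otimes> m \<in> double_coset G H x"
      "m \<otimes> (h \<otimes> x \<otimes> l) \<in> double_coset G H x"
      unfolding double_coset_def mem_rcoset_mult_iff using that by blast+
  qed
  then have "y \<otimes> m \<in> double_coset G H x" "m \<otimes> y \<in> double_coset G H x"
    if "y \<in> double_coset G H x" "m \<in> H" for y m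
    using that unfolding double_coset_def mem_rcoset_mult_iff[of y] by blast+
  then show ?thesis
    unfolding bi_invariant_def right_invariant_def
    using double_coset_subset_carrier[OF H x] by blast
qed

lemma bi_invariant_UN:
  assumes "\<And>i. i \<in> I \<Longrightarrow> T i \<in> bi_invariant H"
  shows "(\<Union>i\<in>I. T i) \<in> bi_invariant H"
proof -
  have "x \<otimes> h \<in> T i" "h \<otimes> x \<in> T i" if "i \<in> I" "x \<in> T i" "h \<in> H" for i x h
    using assms[OF that(1)] that(2,3) unfolding bi_invariant_def right_invariant_def by auto
  moreover have "T i \<subseteq> carrier G" if "i \<in> I" for i
    using assms[OF that] unfolding bi_invariant_def right_invariant_def by simp
  ultimately show ?thesis
    unfolding bi_invariant_def right_invariant_def by blast
qed

lemma card_double_coset: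
  assumes "finite (carrier G)" "subgroup H G" "x \<in> carrier G"
  shows "card (double_coset G H x) = card H * coset_degree G H x"
proof -
  have "double_coset G H x \<in> right_invariant H"
    using double_coset_bi_invariant[OF assms(2,3)] unfolding bi_invariant_def by blast
  then have "\<Union>{C \<in> lcosets H. C \<subseteq> double_coset G H x} = double_coset G H x"
    by (rule Union_lcosets_right_invariant[OF assms(2)])
  moreover have "card (\<Union>{C \<in> lcosets H. C \<subseteq> double_coset G H x}) = card H * coset_degree G H x"
    unfolding coset_degree_def by (rule card_Union_lcosets[OF assms(1,2)]) blast
  ultimately show ?thesis by simp
qed

lemma card_lcoset_index:
  assumes fin: "finite (carrier G)" and H: "subgroup H G" and K: "subgroup K G" "H \<subseteq> K"
  shows "card K = card H * lcoset_index G K H"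
proof -
  interpret K: group "G\<lparr>carrier := K\<rparr>"
    using K(1) by (rule subgroup_imp_group)
  have "finite K" using K(1) fin subgroup.subset finite_subset by metis
  then show ?thesis
    using K.l_lagrange[of H] subgroup_incl[OF H K]
    by (simp add: lcoset_index_def order_def mult.commute)
qed

text \<open>The two factors from \<open>H\<close> in an element of the double coset are absorbed:
  the left one into \<open>A\<close>, the inverse of the right one into \<open>B\<close>.\<close>

lemma rcoset_meets_iff:
  assumes H: "subgroup H G" and A: "A \<in> right_invariant H" and B: "B \<in> right_invariant H"
    and x: "x \<in> carrier G"
  shows "(A #> x) \<inter> B \<noteq> {} \<longleftrightarrow> (A <#> double_coset G H x) \<inter> B \<noteq> {}"
proof
  assume "(A #> x) \<inter> B \<noteq> {}"
  then obtain a where a: "a \<in> A" "a \<otimes> x \<in> B" by (auto simp: r_coset_def)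
  have "\<one> \<otimes> x \<otimes> \<one> \<in> double_coset G H x"
    unfolding double_coset_def mem_rcoset_mult_iff using subgroup.one_closed[OF H] by blast
  then have "a \<otimes> x \<in> A <#> double_coset G H x"
    using a x by (auto simp: set_mult_def)
  with a show "(A <#> double_coset G H x) \<inter> B \<noteq> {}" by blast
next
  assume "(A <#> double_coset G H x) \<inter> B \<noteq> {}"
  then obtain a h l where a: "a \<in> A" "h \<in> H" "l \<in> H" "a \<otimes> (h \<otimes> x \<otimes> l) \<in> B"
    unfolding set_mult_def double_coset_def by (auto simp: r_coset_def)
  have c: "a \<in> carrier G" "h \<in> carrier G" "l \<in> carrier G"
    using a A H by (auto simp: right_invariant_def subgroup.mem_carrier)
  have "inv l \<in> H" using a H by (simp add: subgroup.m_inv_closed)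
  then have "a \<otimes> (h \<otimes> x \<otimes> l) \<otimes> inv l \<in> B"
    using a B by (simp add: right_invariant_def)
  moreover have "a \<otimes> (h \<otimes> x \<otimes> l) \<otimes> inv l = a \<otimes> h \<otimes> x"
    using c x by (simp add: m_assoc)
  moreover have "a \<otimes> h \<in> A" using a A by (simp add: right_invariant_def)
  ultimately show "(A #> x) \<inter> B \<noteq> {}"
    by (auto simp: r_coset_def)
qed

section \<open>Edges of the coset digraph and completeness\<close>

lemma arcs_ends_cayley_coset_digraph_iff:
  assumes H: "subgroup H G" and S: "S \<subseteq> carrier G"
  shows "(A, B) \<in> arcs_ends (cayley_coset_digraph G H S) \<longleftrightarrow>
    A \<in> lcosets H \<and> B \<in> lcosets H \<and> (A <#> (\<Union>x\<in>S. double_coset G H x)) \<inter> B \<noteq> {}"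
proof -
  have "(A, B) \<in> arcs_ends (cayley_coset_digraph G H S) \<longleftrightarrow>
    A \<in> lcosets H \<and> B \<in> lcosets H \<and> (\<exists>x\<in>S. (A #> x) \<inter> B \<noteq> {})"
    by (auto simp: arcs_ends_conv cayley_coset_digraph_def)
  moreover have "(\<exists>x\<in>S. (A #> x) \<inter> B \<noteq> {}) \<longleftrightarrow> (\<exists>x\<in>S. (A <#> double_coset G H x) \<inter> B \<noteq> {})"
    if "A \<in> lcosets H" "B \<in> lcosets H"
    using rcoset_meets_iff[OF H lcoset_right_invariant[OF H that(1)]
        lcoset_right_invariant[OF H that(2)]] S by blast
  moreover have "(\<exists>x\<in>S. (A <#> double_coset G H x) \<inter> B \<noteq> {}) \<longleftrightarrow>
      (A <#> (\<Union>x\<in>S. double_coset G H x)) \<inter> B \<noteq> {}"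
    unfolding set_mult_def by blast
  ultimately show ?thesis by blast
qed

lemma not_mem_double_coset:
  assumes H: "subgroup H G" and x: "x \<in> carrier G - H" and h: "h \<in> H"
  shows "h \<notin> double_coset G H x"
proof
  assume "h \<in> double_coset G H x"
  then obtain l m where lm: "l \<in> H" "m \<in> H" "h = l \<otimes> x \<otimes> m"
    unfolding double_coset_def mem_rcoset_mult_iff by blast
  have c: "l \<in> carrier G" "m \<in> carrier G" using lm H by (auto simp: subgroup.mem_carrier)
  have "inv l \<otimes> (h \<otimes> inv m) \<in> H"
    using lm(1,2) h by (auto intro!: subgroup.m_closed[OF H] subgroup.m_inv_closed[OF H])
  moreover have "h \<otimes> inv m = l \<otimes> x"
    using lm c x by (simp add: m_assoc)
  moreover have "inv l \<otimes> (l \<otimes> x) = x"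
    using c x by (simp add: m_assoc[symmetric])
  ultimately show False using x by simp
qed

text \<open>For representatives of distinct cosets, \<open>inv a \<otimes> b\<close> is outside
  \<open>H\<close> and so in one of the double cosets, which gives an edge; there are no loops
  because these double cosets miss \<open>H\<close>. The contrapositive supplies an element outside
  \<open>H\<close> and all the double cosets when the digraph is not complete.\<close>

lemma cayley_coset_digraph_complete:
  assumes fin: "finite (carrier G)" and H: "subgroup H G" and S: "S \<subseteq> carrier G - H"
    and cover: "H \<union> (\<Union>x\<in>S. double_coset G H x) = carrier G"
  shows "is_complete (cayley_coset_digraph G H S)"
proof -
  let ?D = "cayley_coset_digraph G H S" and ?T = "\<Union>x\<in>S. double_coset G H x"
  have Sc: "S \<subseteq> carrier G" using S by blast
  have verts: "verts ?D = lcosets H" by (simp add: cayley_coset_digraph_def)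
  have finV: "finite (lcosets H)"
    using fin by (auto simp: LCOSETS_def)
  have ends: "arcs_ends ?D = arcs ?D"
    by (force simp: arcs_ends_conv cayley_coset_digraph_def)
  have iff: "(A, B) \<in> arcs_ends ?D \<longleftrightarrow> A \<in> lcosets H \<and> B \<in> lcosets H \<and> A \<noteq> B" for A B
  proof (cases "A \<in> lcosets H \<and> B \<in> lcosets H")
    case True
    then obtain a b where ab: "a \<in> carrier G" "b \<in> carrier G" "A = a <# H" "B = b <# H"
      by (auto simp: LCOSETS_def)
    have "(A <#> ?T) \<inter> B \<noteq> {} \<longleftrightarrow> A \<noteq> B"
    proof
      assume "(A <#> ?T) \<inter> B \<noteq> {}"
      show "A \<noteq> B"
      proof
        assume "A = B"
        with \<open>(A <#> ?T) \<inter> B \<noteq> {}\<close> have "(A <#> ?T) \<inter> A \<noteq> {}" by simp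
        then obtain h t l where
          t: "h \<in> H" "l \<in> H" "t \<in> ?T" "a \<otimes> h \<otimes> t = a \<otimes> l"
          unfolding set_mult_def ab(3) l_coset_def by blast
        have c: "h \<in> carrier G" "l \<in> carrier G" "t \<in> carrier G"
          using t H cover by (auto simp: subgroup.mem_carrier)
        have "a \<otimes> (h \<otimes> t) = a \<otimes> l"
          using t(4) ab c by (simp add: m_assoc)
        then have "h \<otimes> t = l"
          using ab(1) c by (metis Units_eq Units_l_cancel m_closed)
        then have "t = inv h \<otimes> l"
          using c by (simp add: inv_solve_left)
        then have "t \<in> H"
          using t H by (simp add: subgroup.m_closed subgroup.m_inv_closed)
        then show False
          using t(3) not_mem_double_coset[OF H] S by blast
      qed
    next
      assume ne: "A \<noteq> B"
      have "inv a \<otimes> b \<notin> H"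
      proof
        assume "inv a \<otimes> b \<in> H"
        then have "a \<otimes> (inv a \<otimes> b) \<in> A"
          unfolding ab(3) l_coset_def by blast
        then have "b \<in> A" using ab by (simp add: m_assoc[symmetric])
        moreover have "b \<in> B" using ab lcos_self H by blast
        ultimately show False
          using lcos_disjoint[OF H] True ne by blast
      qed
      moreover have "inv a \<otimes> b \<in> carrier G" using ab by simp
      ultimately have "inv a \<otimes> b \<in> ?T" using cover by blast
      moreover have "a \<in> A" "b \<in> B" using ab lcos_self H by blast+
      moreover have "b = a \<otimes> (inv a \<otimes> b)" using ab by (simp add: m_assoc[symmetric])
      ultimately have "b \<in> A <#> ?T" unfolding set_mult_def by blast
      with \<open>b \<in> B\<close> show "(A <#> ?T) \<inter> B \<noteq> {}" by blast
    qed
    then show ?thesis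
      using True arcs_ends_cayley_coset_digraph_iff[OF H Sc] by blast
  next
    case False
    then show ?thesis
      using arcs_ends_cayley_coset_digraph_iff[OF H Sc] by blast
  qed
  then have all: "arcs_ends ?D = {(u, v). (u, v) \<in> verts ?D \<times> verts ?D \<and> u \<noteq> v}"
    unfolding verts by auto
  have proj: "tail ?D = fst" "head ?D = snd"
    by (simp_all add: cayley_coset_digraph_def)
  have arcs: "arcs ?D = {(u, v). (u, v) \<in> (lcosets H) \<times> (lcosets H) \<and> u \<noteq> v}"
    using all ends verts by simp
  \<comment> \<open>Besides the right edges, \<open>complete_digraph\<close> demands a finite
    symmetric digraph without loops or parallel arcs.\<close>
  have "finite (arcs ?D)"
    by (rule finite_subset[OF _ finite_cartesian_product[OF finV finV]]) (auto simp: arcs)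
  moreover have "symmetric ?D"
    unfolding symmetric_def all by (auto intro: symI)
  ultimately have "graph ?D"
    using finV by unfold_locales (auto simp: proj verts arcs arc_to_ends_def)
  then show ?thesis
    unfolding complete_digraph_def using all by simp
qed

text \<open>Deleting the out-neighbours of the vertex \<open>H\<close> isolates it from some other
  coset, and there are at most as many of them as the degree.\<close>

lemma cayley_coset_separator_exists:
  assumes fin: "finite (carrier G)" and H: "subgroup H G" and S: "S \<subseteq> carrier G - H"
    and not_complete: "\<not> is_complete (cayley_coset_digraph G H S)"
  obtains X where "X \<subseteq> lcosets H" "card X \<le> cayley_coset_degree G H S"
    "\<not> strongly_connected (cayley_coset_digraph G H S \<restriction> (lcosets H - X))"
proof -
  let ?D = "cayley_coset_digraph G H S"
  define T where "T = (\<Union>x\<in>S. double_coset G H x)"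
  have Sc: "S \<subseteq> carrier G" and finS: "finite S"
    using S fin finite_subset by blast+
  have T: "T \<in> bi_invariant H"
    unfolding T_def using double_coset_bi_invariant[OF H] Sc by (intro bi_invariant_UN) blast
  then have Tr: "T \<in> right_invariant H" by (simp add: bi_invariant_def)
  \<comment> \<open>The out-neighbours of the vertex \<open>H\<close> are exactly the cosets
    contained in \<open>T\<close>.\<close>
  define X where "X = {C \<in> lcosets H. C \<subseteq> T}"
  have "card H * card X = card T"
    using card_Union_lcosets[OF fin H, of X] Union_lcosets_right_invariant[OF H Tr]
    by (simp add: X_def)
  also have "\<dots> \<le> (\<Sum>x\<in>S. card (double_coset G H x))"
    unfolding T_def by (rule card_UN_le[OF finS])
  also have "\<dots> = card H * cayley_coset_degree G H S"
    using card_double_coset[OF fin H] Sc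
    by (auto simp: cayley_coset_degree_def sum_distrib_left intro!: sum.cong)
  finally have "card X \<le> cayley_coset_degree G H S"
    using subgroup.finite_imp_card_positive[OF H fin] by simp
  moreover have "\<not> strongly_connected (?D \<restriction> (lcosets H - X))"
  proof
    let ?D' = "?D \<restriction> (lcosets H - X)"
    assume sc: "strongly_connected ?D'"
    have "H \<union> T \<noteq> carrier G"
      using not_complete cayley_coset_digraph_complete[OF fin H S] T_def by blast
    moreover have "H \<union> T \<subseteq> carrier G"
      using subgroup.subset[OF H] Tr by (auto simp: right_invariant_def)
    ultimately obtain x where x: "x \<in> carrier G" "x \<notin> H" "x \<notin> T" by blast
    have x_self: "x \<in> x <# H" using lcos_self[OF x(1) H] .
    have one: "\<one> \<in> H" using subgroup.one_closed[OF H] .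
    have "\<one> <# H = H" using lcos_mult_one subgroup.subset[OF H] by blast
    then have HV: "H \<in> lcosets H" by (force simp: LCOSETS_def)
    have "\<one> \<notin> T" unfolding T_def using not_mem_double_coset[OF H _ one] S by blast
    then have H': "H \<in> verts ?D'" using HV one by (auto simp: X_def)
    have x': "x <# H \<in> verts ?D'" using x x_self by (auto simp: X_def LCOSETS_def)
    have "H \<rightarrow>\<^sup>*\<^bsub>?D'\<^esub> (x <# H)"
      using sc H' x' unfolding strongly_connected_def by blast
    \<comment> \<open>Along a path starting at \<open>H\<close> one never leaves \<open>H\<close>:
      an edge from \<open>H\<close> ends in a coset that meets \<open>T\<close>, hence is contained
      in \<open>T\<close> and has been deleted.\<close>
    then have "x <# H = H"
      unfolding reachable_def
    proof (induction rule: rtrancl_on_induct)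
      case base
      show ?case ..
    next
      case (step B C)
      then have "(H, C) \<in> arcs_ends ?D" and C: "C \<notin> X" "C \<in> lcosets H"
        by (auto simp: arcs_ends_conv)
      then have "(H <#> T) \<inter> C \<noteq> {}"
        using arcs_ends_cayley_coset_digraph_iff[OF H Sc] T_def by blast
      moreover have "H <#> T \<subseteq> T"
        using T by (auto simp: set_mult_def bi_invariant_def)
      ultimately obtain y where y: "y \<in> T" "y \<in> C" by blast
      have "y <# H \<subseteq> T" using lcoset_subset_right_invariant[OF Tr y(1)] .
      moreover have "y <# H = C"
      proof -
        have yc: "y \<in> carrier G" using y C lcosets_part_G[OF H] by blast
        then have "y <# H \<in> lcosets H" "y \<in> y <# H"
          using lcos_self[OF _ H] by (auto simp: LCOSETS_def)
        then show ?thesis using lcos_disjoint[OF H _ C(2)] y(2) by blast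
      qed
      ultimately show ?case using C X_def by blast
    qed
    then show False using x x_self by blast
  qed
  moreover have "X \<subseteq> lcosets H" by (auto simp: X_def)
  ultimately show thesis using that by blast
qed

text \<open>Take for \<open>F\<close> the union of the cosets reachable from a suitable one after deleting \<open>X\<close>.\<close>

lemma separator_fragment:
  assumes H: "subgroup H G" and S: "S \<subseteq> carrier G" and X: "X \<subset> lcosets H"
    and nsc: "\<not> strongly_connected (cayley_coset_digraph G H S \<restriction> (lcosets H - X))"
  obtains F where "F \<in> right_invariant H" "F \<noteq> {}"
    "F \<union> (F <#> (\<Union>x\<in>S. double_coset G H x)) \<noteq> carrier G"
    "(F <#> (\<Union>x\<in>S. double_coset G H x)) - F \<subseteq> \<Union>X"
proof -
  let ?D = "cayley_coset_digraph G H S" and ?T = "\<Union>x\<in>S. double_coset G H x"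
  let ?D' = "?D \<restriction> (lcosets H - X)"
  have verts': "verts ?D' = lcosets H - X" by simp
  \<comment> \<open>As \<open>X\<close> is a proper subset, some vertices remain, so strong
    connectivity fails at a pair of them and not because the digraph is empty.\<close>
  obtain u v where uv: "u \<in> lcosets H - X" "v \<in> lcosets H - X" "\<not> u \<rightarrow>\<^sup>*\<^bsub>?D'\<^esub> v"
    using nsc X unfolding strongly_connected_def verts' by blast
  define R where "R = {w. u \<rightarrow>\<^sup>*\<^bsub>?D'\<^esub> w}"
  define F where "F = \<Union>R"
  have R: "R \<subseteq> lcosets H - X"
    using reachable_in_vertsE[of ?D' u] unfolding R_def verts' by blast
  have uR: "u \<in> R" using uv by (simp add: R_def reachable_def)
  have "F \<in> right_invariant H"
    using R lcoset_right_invariant[OF H] unfolding F_def right_invariant_def by blast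
  moreover have "F \<noteq> {}"
  proof -
    obtain a where "a \<in> carrier G" "u = a <# H" using uv by (auto simp: LCOSETS_def)
    then have "a \<in> F" using uR lcos_self[OF _ H] F_def by blast
    then show ?thesis by blast
  qed
  \<comment> \<open>A coset entered by an edge from a reachable coset is itself reachable unless it
    was deleted.\<close>
  moreover have bd: "(F <#> ?T) - F \<subseteq> \<Union>X"
  proof
    fix y assume y: "y \<in> (F <#> ?T) - F"
    then obtain A where A: "A \<in> R" "y \<in> A <#> ?T"
      unfolding F_def set_mult_def by blast
    have "?T \<subseteq> carrier G" using double_coset_subset_carrier[OF H] S by blast
    moreover have "A \<subseteq> carrier G" using A R lcosets_part_G[OF H] by blast
    ultimately have yc: "y \<in> carrier G" using A set_mult_closed by blast
    have yy: "y \<in> y <# H" "y <# H \<in> lcosets H"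
      using lcos_self[OF yc H] yc by (auto simp: LCOSETS_def)
    have "(A, y <# H) \<in> arcs_ends ?D"
      using arcs_ends_cayley_coset_digraph_iff[OF H S] A R yy by blast
    moreover have "y <# H \<notin> R" using y yy F_def by blast
    ultimately have "y <# H \<in> X"
    proof -
      have False if "y <# H \<notin> X"
      proof -
        have "(A, y <# H) \<in> arcs_ends ?D'"
          using \<open>(A, y <# H) \<in> arcs_ends ?D\<close> A R yy that by (auto simp: arcs_ends_conv)
        then have "u \<rightarrow>\<^sup>*\<^bsub>?D'\<^esub> (y <# H)"
          using A(1) yy that unfolding R_def reachable_def
          by (auto intro: rtrancl_on_into_rtrancl_on)
        then show False using \<open>y <# H \<notin> R\<close> R_def by blast
      qed
      then show ?thesis by blast
    qed
    with yy show "y \<in> \<Union>X" by blast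
  qed
  moreover have "F \<union> (F <#> ?T) \<noteq> carrier G"
  proof -
    \<comment> \<open>\<open>v\<close> is neither reachable nor deleted, so its elements avoid both
      \<open>F\<close> and the boundary of \<open>F\<close>.\<close>
    obtain b where b: "b \<in> carrier G" "v = b <# H" using uv by (auto simp: LCOSETS_def)
    then have bv: "b \<in> v" using lcos_self[OF _ H] by blast
    have "v \<notin> R" using uv by (simp add: R_def)
    then have "b \<notin> F"
      unfolding F_def using bv R uv lcos_disjoint[OF H] by blast
    moreover have "b \<notin> \<Union>X"
      using bv X uv lcos_disjoint[OF H] by blast
    ultimately show ?thesis using bd b by blast
  qed
  ultimately show thesis using that by blast
qed

end

text \<open>The out-neighbourhood of one vertex gives a separator of at most the size of the degree.
  Conversely, every separator yields a fragment, from it a proper subgroup with no larger boundary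
  for \<open>T\<close> or its inverses, and the chain estimate bounds that boundary from
  below.\<close>

theorem (in coset_chain) vertex_connectivity_eq_degree:
  assumes bij: "bij_betw s {1..k} S" and S: "S \<subseteq> carrier G - H"
    and generates: "gen_chain G H s k = carrier G"
    and not_complete: "\<not> is_complete (cayley_coset_digraph G H S)"
  shows "vertex_connectivity (cayley_coset_digraph G H S) = cayley_coset_degree G H S"
proof -
  interpret opp: coset_chain G H "\<lambda>j. inv (s j)" k
    by (rule coset_chain_inv)
  let ?D = "cayley_coset_digraph G H S" and ?d = "cayley_coset_degree G H S"
  define T where "T = (\<Union>x\<in>S. double_coset G H x)"
  have img: "s ` {1..k} = S" using bij by (simp add: bij_betw_def)
  have Sc: "S \<subseteq> carrier G" using S by blast
  have s_mem: "s i \<in> S" "s i \<in> carrier G" if "i \<in> {1..k}" for i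
    using img Sc that by blast+
  have card_H: "0 < card H" using subgroup.finite_imp_card_positive[OF H fin] .
  have T_chain: "T = (\<Union>j\<in>{1..k}. double_coset G H (s j))"
    unfolding T_def img[symmetric] by blast
  have T_inv: "m_inv G ` T = (\<Union>j\<in>{1..k}. double_coset G H (inv (s j)))"
    unfolding T_chain image_UN using double_coset_inv[OF H s_mem(2)] by auto
  have T: "T \<in> bi_invariant H"
    unfolding T_def using double_coset_bi_invariant[OF H] Sc by (intro bi_invariant_UN) blast
  have "card H * ?d = (\<Sum>x\<in>S. card (double_coset G H x))"
    using card_double_coset[OF fin H] Sc
    by (auto simp: cayley_coset_degree_def sum_distrib_left intro!: sum.cong)
  also have "\<dots> = (\<Sum>j = 1..k. card (double_coset G H (s j)))"
    by (rule sum.reindex_bij_betw[OF bij, symmetric])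
  finally have degree: "card H * ?d = (\<Sum>j = 1..k. card (double_coset G H (s j)))" .
  have degree_inv: "card H * ?d = (\<Sum>j = 1..k. card (double_coset G H (inv (s j))))"
    unfolding degree using card_double_coset_inv[OF H s_mem(2)] by (intro sum.cong) auto

  \<comment> \<open>Without generators \<open>H\<close> would be the whole group, and the digraph
    with a single vertex is complete.\<close>
  have k1: "1 \<le> k"
  proof (rule ccontr)
    assume "\<not> 1 \<le> k"
    then have "k = 0" "S = {}" using img by auto
    then have "carrier G \<subseteq> H"
      using generates chain_subset[OF H, of 0] by auto
    then have "H \<union> (\<Union>x\<in>S. double_coset G H x) = carrier G"
      using \<open>S = {}\<close> subgroup.subset[OF H] by auto
    then show False
      using cayley_coset_digraph_complete[OF fin H S] not_complete by blast
  qed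
  have bound: "card H * ?d \<le> card ((K <#> T') - K)"
    if "subgroup K G" "H \<subseteq> K" "K \<noteq> carrier G" "T' = T \<or> T' = m_inv G ` T" for K T'
    using that(4)
  proof
    assume "T' = T"
    then show ?thesis
      using sum_le_card_boundary[OF k1 generates that(1-3)] unfolding degree T_chain by simp
  next
    assume "T' = m_inv G ` T"
    moreover have "gen_chain G H (\<lambda>j. inv (s j)) k = carrier G"
      using gen_chain_inv generates by simp
    ultimately show ?thesis
      using opp.sum_le_card_boundary[OF k1 _ that(1-3)] unfolding degree_inv T_inv by simp
  qed

  have lower: "?d \<le> card X"
    if X: "X \<subseteq> lcosets H" and nsc: "\<not> strongly_connected (?D \<restriction> (lcosets H - X))" for X
  proof -
    have finUX: "finite (\<Union>X)"
      by (rule finite_subset[OF _ fin]) (use X lcosets_part_G[OF H] in blast)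
    have "card H * ?d \<le> card (\<Union>X)"
    proof (cases "X = lcosets H")
      case True
      \<comment> \<open>Deleting all vertices leaves no pair from which to build a fragment. The
        estimate is applied to the subgroup \<open>H\<close> instead, whose boundary certainly lies
        in the union of all cosets.\<close>
      have "H \<noteq> carrier G" using s_mem(1)[of 1] k1 S by auto
      then have "card H * ?d \<le> card ((H <#> T) - H)"
        using bound[OF H order_refl] by blast
      moreover have "(H <#> T) - H \<subseteq> \<Union>X"
        using True lcosets_part_G[OF H] set_mult_closed[OF subgroup.subset[OF H]] T
        by (auto simp: bi_invariant_def right_invariant_def)
      ultimately show ?thesis
        using card_mono[OF finUX] le_trans by blast
    next
      case False
      then obtain F where F: "F \<in> right_invariant H" "F \<noteq> {}"
        "F \<union> (F <#> T) \<noteq> carrier G" "(F <#> T) - F \<subseteq> \<Union>X"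
        using separator_fragment[OF H Sc _ nsc] X unfolding T_def by blast
      obtain K T' where K: "subgroup K G" "H \<subseteq> K" "K \<noteq> carrier G" "T' = T \<or> T' = m_inv G ` T"
        "card ((K <#> T') - K) \<le> card ((F <#> T) - F)"
        using subgroup_boundary_le[OF fin H T F(1-3)] .
      then show ?thesis
        using bound[OF K(1-4)] card_mono[OF finUX F(4)] by linarith
    qed
    then show ?thesis
      using card_Union_lcosets[OF fin H X] card_H by simp
  qed

  let ?P = "\<lambda>n. \<exists>X \<subseteq> lcosets H. card X = n \<and> \<not> strongly_connected (?D \<restriction> (lcosets H - X))"
  have "verts ?D = lcosets H" by (simp add: cayley_coset_digraph_def)
  then have kappa: "vertex_connectivity ?D = (LEAST n. ?P n)"
    using not_complete by (simp add: vertex_connectivity_def)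
  obtain X where X: "X \<subseteq> lcosets H" "card X \<le> ?d"
    "\<not> strongly_connected (?D \<restriction> (lcosets H - X))"
    using cayley_coset_separator_exists[OF fin H S not_complete] .
  then have "card X = ?d" using lower le_antisym by blast
  then have "?P ?d" using X by blast
  then show ?thesis
    unfolding kappa by (rule Least_equality) (use lower in blast)
qed

theorem theorem18:
  fixes G :: "('a, 'b) monoid_scheme" and H S :: "'a set" and s :: "nat \<Rightarrow> 'a" and k :: nat
  assumes "group G" and "finite (carrier G)" and "subgroup H G"
    and "bij_betw s {1..k} S"
    and "S \<subseteq> carrier G - H"
    and "inj_on (double_coset G H) S"
    and "generate G (H \<union> S) = carrier G"
    and "\<not> is_complete (cayley_coset_digraph G H S)"
    and "hierarchical G H s k"
    and "\<And>i. 1 \<le> i \<Longrightarrow> i < k \<Longrightarrow>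
           coset_degree G H (s (i + 1)) \<le> (\<Sum>j = 1..i. coset_degree G H (s j))"
    and "2 \<le> k \<Longrightarrow>
           (\<Sum>j = 1..2. coset_degree G H (s j)) \<le> lcoset_index G (gen_chain G H s 1) H"
  shows "vertex_connectivity (cayley_coset_digraph G H S) = cayley_coset_degree G H S"
proof -
  interpret group G by fact
  note fin = assms(2) and H = assms(3)
  have img: "s ` {1..k} = S" using assms(4) by (simp add: bij_betw_def)
  have Sc: "S \<subseteq> carrier G" using assms(5) by blast
  have s_mem: "s i \<in> S" "s i \<in> carrier G" if "i \<in> {1..k}" for i
    using img Sc that by blast+
  have sum_card: "(\<Sum>j = 1..i. card (double_coset G H (s j)))
      = card H * (\<Sum>j = 1..i. coset_degree G H (s j))" if "i \<le> k" for i
    using card_double_coset[OF fin H s_mem(2)] that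
    by (auto simp: sum_distrib_left intro!: sum.cong)
  have gens: "H \<union> s ` {1..i} \<subseteq> carrier G" if "i \<le> k" for i
    using subgroup.subset[OF H] s_mem(2) that by fastforce
  have sub: "subgroup (gen_chain G H s i) G" if "i \<le> k" for i
    unfolding gen_chain_def by (rule generate_is_subgroup[OF gens[OF that]])
  \<comment> \<open>The numerical hypotheses are multiplied by the order of \<open>H\<close>.
    Distinctness of the subgroups gives \<open>s_notin\<close>, since a generator in the previous
    subgroup would make two consecutive ones equal.\<close>
  interpret chain: coset_chain G H s k
  proof (intro coset_chain.intro coset_chain_axioms.intro)
    show "s (Suc i) \<notin> gen_chain G H s i" if i: "1 \<le> i" "i < k" for i
    proof
      assume "s (Suc i) \<in> gen_chain G H s i"
      moreover have "H \<union> s ` {1..i} \<subseteq> gen_chain G H s i"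
        unfolding gen_chain_def by (auto intro: generate.incl)
      ultimately have "H \<union> s ` {1..Suc i} \<subseteq> gen_chain G H s i"
        by (simp add: atLeastAtMostSuc_conv)
      then have "gen_chain G H s (Suc i) \<subseteq> gen_chain G H s i"
        unfolding gen_chain_def[of G H s "Suc i"]
        using i by (intro generate_subgroup_incl sub) auto
      moreover have "gen_chain G H s i \<subseteq> gen_chain G H s (Suc i)"
        unfolding gen_chain_def by (intro mono_generate) auto
      ultimately have "gen_chain G H s i = gen_chain G H s (Suc i)" by blast
      then show False
        using assms(9) i unfolding hierarchical_def by (auto dest: inj_onD)
    qed
    show "card (double_coset G H (s (Suc i))) \<le> (\<Sum>j = 1..i. card (double_coset G H (s j)))"
      if i: "1 \<le> i" "i < k" for i
      using assms(10)[OF i] sum_card[of i] card_double_coset[OF fin H s_mem(2)[of "Suc i"]] i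
      by simp
    show "(\<Sum>j = 1..2. card (double_coset G H (s j))) \<le> card (gen_chain G H s 1)" if "2 \<le> k"
    proof -
      have "H \<subseteq> gen_chain G H s 1"
        unfolding gen_chain_def by (auto intro: generate.incl)
      then have "card (gen_chain G H s 1) = card H * lcoset_index G (gen_chain G H s 1) H"
        using that by (intro card_lcoset_index fin H sub) auto
      then show ?thesis
        using assms(11)[OF that] sum_card[OF that] by simp
    qed
    show "s i \<in> carrier G" if "i \<in> {1..k}" for i
      using s_mem(2)[OF that] .
  qed (fact group_axioms fin H)+
  have "gen_chain G H s k = carrier G"
    unfolding gen_chain_def img by (rule assms(7))
  then show ?thesis
    using chain.vertex_connectivity_eq_degree[OF assms(4,5)] assms(8) by blast
qed

end
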